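(* Let $\{f_t:t\in\mathbb{D}\}$ be a meromorphic family of complex rational functions of degree $d\ge2$ that is degenerate at $t=0$, let $X=\mathbb{D}\times\mathbb{P}^1$, let $\pi:Y\to X$ be the minimal modification such that the induced meromorphic map $F:X\dashrightarrow Y$ is nonconstant on the central fiber $X_0$, and let $\mu_t$ be the measure of maximal entropy of $f_t$ for $t\neq0$. Then any weak limit $\mu_0$ of the measures $\mu_t$ on the central fiber $Y_0$ of $Y$ satisfies $$\frac1d F^*\mu_0=\pi_*\mu_0$$ as measures on the central fiber $X_0$ of $X$.
   Context: **Families.** $\mathrm{Rat}_d$ (complex rational functions of degree exactly $d$) is identified via coefficients with the complement in $\overline{\mathrm{Rat}}_d=\mathbb{P}^{2d+1}(\mathbb{C})$ of the resultant hypersurface $\partial\mathrm{Rat}_d$; points of $\overline{\mathrm{Rat}}_d$ are pairs $\Phi=(P,Q)$ of homogeneous degree-$d$ polynomials in two variables up to scaling. Put $H=\gcd(P,Q)$; the reduction $\phi$ of $\Phi$ is the rational function $P/Q$; for $x\in\mathbb{P}^1$ put $s(x)=\mathrm{ord}_xH$. A meromorphic family $\{f_t:t\in\mathbb{D}\}$ is a holomorphic map $\mathbb{D}\to\overline{\mathrm{Rat}}_d$ with image not contained in $\partial\mathrm{Rat}_d$; it is degenerate at $0$ if $f_0\in\partial\mathrm{Rat}_d$. Shrink $\mathbb{D}$ around $0$ so that $f_t\in\mathrm{Rat}_d$ for $t\ne0$. The measure of maximal entropy $\mu_t$ of $f_t$ is the unique Borel probability measure on $\mathbb{P}^1$ with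 $\frac1d f_t^*\mu_t=\mu_t$ not charging exceptional points. **The surfaces.** $X=\mathbb{D}\times\mathbb{P}^1$, $X_0=\{0\}\times\mathbb{P}^1$, and $F(t,z)=(t,f_t(z))$ for $t\neq0$. There is a meromorphic family $\{A_t\}$ of Möbius transformations (in $\mathrm{Rat}_1$ for $t\ne0$, $\mathbb{D}$ shrunk if needed) such that $A_t\circ f_t$ converges in $\overline{\mathrm{Rat}}_d$ as $t\to0$ to a point $\Phi$ with nonconstant reduction $\phi$; if the reduction of $f_0$ is nonconstant take $A_t=\mathrm{id}$. Let $H,s(x)$ be the quantities associated to $\Phi$. If the reduction of $f_0$ is nonconstant, $Y=X$ and $\pi=\mathrm{id}$. Otherwise $Y\ne X$ is the (unique up to isomorphism) minimal modification $\pi:Y\to X$ (an isomorphism over $t\ne0$, possibly singular) for which $F:X\dashrightarrow Y$ is nonconstant on $X_0$; concretely $Y$ is the closure in $\mathbb{D}\times\mathbb{P}^1\times\mathbb{P}^1$ of $\{(t,z,A_t(z)):t\neq0\}$ with $\pi(t,z,w)=(t,z)$. In that case $Y_0=C_0\cup E_0$, two copies of $\mathbb{P}^1$ meeting in one point, where $E_0$ (with coordinate $w$) is collapsed to a point by $\pi$ and $C_0$ is mapped isomorphically onto $X_0$ by $\pi$. Let $\pi_E:Y_0\to E_0$ be the continuous projection collapsing $C_0$ to a point and equal to the identity on $E_0$. Away from indeterminacy, $F$ maps $X_0$ to $E_0$ (to $Y_0=X_0$ if $Y=X$) by $\phi$. **Pullback.** For a Borel probability measure $\mu$ on $Y_0$,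 $F^*\mu$ is the measure on $X_0=\mathbb{P}^1$ defined by $F^*\mu=\phi^*\mu+\sum_{x}s(x)\delta_x$ if $Y=X$, and $F^*\mu=\phi^*(\pi_E)_*\mu+\sum_{x}s(x)\delta_x$ if $Y\ne X$, where $\int\psi\,d(\phi^*\nu)=\int\phi_*\psi\,d\nu$, $\phi_*\psi(y)=\sum_{\phi(x)=y}\psi(x)$ with multiplicity. **Weak limits.** View $\mu_t$ as a measure on the fiber $Y_t\cong\mathbb{P}^1$ (identified via $\pi$), $t\ne0$. A measure $\mu_0$ on $Y_0$ is a weak limit of $\mu_t$ if there is a sequence $t_n\to0$ with $\int_{Y_{t_n}}\psi\,d\mu_{t_n}\to\int_{Y_0}\psi\,d\mu_0$ for every continuous function $\psi$ on $Y$. *)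

theory Defs
  imports
    "HOL-Probability.Probability"
    "HOL-Computational_Algebra.Polynomial_Factorial"
    "HOL-Computational_Algebra.Field_as_Ring"
begin

section \<open>Complex projective spaces\<close>

definition proj_rel :: "('i \<Rightarrow> complex) \<Rightarrow> ('i \<Rightarrow> complex) \<Rightarrow> bool" where
  "proj_rel u v \<longleftrightarrow> (\<exists>i. u i \<noteq> 0) \<and> (\<exists>c. c \<noteq> 0 \<and> v = (\<lambda>i. c * u i))"

lemma part_equivp_proj_rel: "part_equivp (proj_rel :: ('i \<Rightarrow> complex) \<Rightarrow> _)"
proof (rule part_equivpI)
  have "proj_rel (\<lambda>_::'i. 1) (\<lambda>_. 1)"
    unfolding proj_rel_def by (auto intro: exI[of _ 1])
  then show "\<exists>x :: 'i \<Rightarrow> complex. proj_rel x x" by blast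
  show "symp (proj_rel :: ('i \<Rightarrow> complex) \<Rightarrow> _)"
  proof (rule sympI)
    fix u v :: "'i \<Rightarrow> complex"
    assume "proj_rel u v"
    then obtain i c where *: "u i \<noteq> 0" "c \<noteq> 0" "v = (\<lambda>i. c * u i)"
      by (auto simp: proj_rel_def)
    then have "v i \<noteq> 0" "inverse c \<noteq> 0" "u = (\<lambda>i. inverse c * v i)" by auto
    then show "proj_rel v u" unfolding proj_rel_def by blast
  qed
  show "transp (proj_rel :: ('i \<Rightarrow> complex) \<Rightarrow> _)"
  proof (rule transpI)
    fix u v w :: "'i \<Rightarrow> complex"
    assume "proj_rel u v" "proj_rel v w"
    then obtain i c c' where *: "u i \<noteq> 0" "c \<noteq> 0" "v = (\<lambda>i. c * u i)"
        "c' \<noteq> 0" "w = (\<lambda>i. c' * v i)"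
      by (auto simp: proj_rel_def)
    then have "c' * c \<noteq> 0" "w = (\<lambda>i. (c' * c) * u i)" by (auto simp: mult.assoc)
    with \<open>u i \<noteq> 0\<close> show "proj_rel u w" unfolding proj_rel_def by blast
  qed
qed

text \<open>
  The projective space of the vector space \<open>'i \<Rightarrow> complex\<close>; \<open>rep_cproj\<close> picks homogeneous
  coordinates, \<open>abs_cproj\<close> is the quotient map (meaningful on nonzero vectors only).
\<close>
quotient_type 'i cproj = "'i \<Rightarrow> complex" / partial: proj_rel
  by (rule part_equivp_proj_rel)

instantiation cproj :: (type) topological_space
begin

text \<open>The quotient topology from the nonzero vectors.\<close>
definition open_cproj :: "'a cproj set \<Rightarrow> bool" where
  "open_cproj U \<longleftrightarrow> open {v. (\<exists>i. v i \<noteq> 0) \<and> abs_cproj v \<in> U}"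

instance
proof
  have "{v :: 'a \<Rightarrow> complex. \<exists>i. v i \<noteq> 0} = (\<Union>i. (\<lambda>v. v i) -` (- {0}))"
    by auto
  moreover have "open ((\<lambda>v :: 'a \<Rightarrow> complex. v i) -` (- {0}))" for i
    by (rule open_vimage) (auto intro: continuous_on_product_coordinates)
  ultimately show "open (UNIV :: 'a cproj set)"
    by (simp add: open_cproj_def open_UN)
next
  fix S T :: "'a cproj set"
  assume "open S" "open T"
  then have "open ({v. (\<exists>i. v i \<noteq> 0) \<and> abs_cproj v \<in> S} \<inter>
                   {v. (\<exists>i. v i \<noteq> 0) \<and> abs_cproj v \<in> T})"
    unfolding open_cproj_def by (rule open_Int)
  moreover have "{v. (\<exists>i. v i \<noteq> 0) \<and> abs_cproj v \<in> S} \<inter>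
                 {v. (\<exists>i. v i \<noteq> 0) \<and> abs_cproj v \<in> T} =
                 {v. (\<exists>i. v i \<noteq> 0) \<and> abs_cproj v \<in> S \<inter> T}"
    by auto
  ultimately show "open (S \<inter> T)" by (simp add: open_cproj_def)
next
  fix K :: "'a cproj set set"
  assume "\<forall>S\<in>K. open S"
  then have "open (\<Union>S\<in>K. {v. (\<exists>i. v i \<noteq> 0) \<and> abs_cproj v \<in> S})"
    unfolding open_cproj_def by (intro open_UN) auto
  moreover have "(\<Union>S\<in>K. {v. (\<exists>i. v i \<noteq> 0) \<and> abs_cproj v \<in> S}) =
                 {v. (\<exists>i. v i \<noteq> 0) \<and> abs_cproj v \<in> \<Union>K}"
    by auto
  ultimately show "open (\<Union>K)" by (simp add: open_cproj_def)
qed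

end

text \<open>The affine coordinate \<open>z\<close> corresponds to \<open>[z : 1]\<close>; coordinate \<open>0\<close> comes first.\<close>
type_synonym p1 = "2 cproj"

definition holomorphic_to_proj :: "complex set \<Rightarrow> (complex \<Rightarrow> 'i cproj) \<Rightarrow> bool" where
  "holomorphic_to_proj U f \<longleftrightarrow>
     (\<forall>t\<in>U. \<exists>V g. open V \<and> t \<in> V \<and> V \<subseteq> U \<and> (\<forall>i. (\<lambda>s. g s i) holomorphic_on V) \<and>
                  (\<forall>s\<in>V. (\<exists>i. g s i \<noteq> 0) \<and> f s = abs_cproj (g s)))"


section \<open>Rational functions and their compactified parameter space\<close>

text \<open>
  A pair \<open>(P, Q)\<close> of binary forms of degree \<open>d\<close> up to scaling is a point whose homogeneous
  coordinates at \<open>(0, j)\<close> and \<open>(1, j)\<close> are the coefficients of \<open>x\<^sup>j y\<^bsup>d-j\<^esup>\<close> in \<open>P\<close> and in \<open>Q\<close>.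
  Coordinates with \<open>j > d\<close> vanish, so that \<open>Rat_bar d\<close> is a copy of the projective space of
  dimension \<open>2d + 1\<close>, with the correct subspace topology.
\<close>
type_synonym ratpt = "(2 \<times> nat) cproj"

definition Rat_bar :: "nat \<Rightarrow> ratpt set" where
  "Rat_bar d = {\<Phi>. \<forall>i j. j > d \<longrightarrow> rep_cproj \<Phi> (i, j) = 0}"

text \<open>
  Polynomials in \<open>x, y\<close> are elements of \<open>complex poly poly\<close>, with inner variable \<open>x\<close> and outer
  variable \<open>y\<close>.
\<close>
definition form :: "nat \<Rightarrow> ratpt \<Rightarrow> 2 \<Rightarrow> complex poly poly" where
  "form d \<Phi> i = (\<Sum>j\<le>d. monom (monom (rep_cproj \<Phi> (i, j)) j) (d - j))"

definition eval2 :: "complex poly poly \<Rightarrow> p1 \<Rightarrow> complex" where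
  "eval2 G x = poly (poly G [:rep_cproj x 1:]) (rep_cproj x 0)"

text \<open>The linear form \<open>x\<^sub>1 x - x\<^sub>0 y\<close>, whose zero is the point \<open>[x\<^sub>0 : x\<^sub>1]\<close>.\<close>
definition lin_form :: "p1 \<Rightarrow> complex poly poly" where
  "lin_form x = [: [:0, rep_cproj x 1:], [:- rep_cproj x 0:] :]"

definition ord_at :: "p1 \<Rightarrow> complex poly poly \<Rightarrow> nat" where
  "ord_at x G = multiplicity (lin_form x) G"

text \<open>A pair of forms of degree \<open>d\<close> is a rational function of degree exactly \<open>d\<close> iff it is coprime.\<close>
definition Rat :: "nat \<Rightarrow> ratpt set" where
  "Rat d = {\<Phi> \<in> Rat_bar d. coprime (form d \<Phi> 0) (form d \<Phi> 1)}"

definition bd_Rat :: "nat \<Rightarrow> ratpt set" where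
  "bd_Rat d = Rat_bar d - Rat d"

definition gcd_form :: "nat \<Rightarrow> ratpt \<Rightarrow> complex poly poly" where
  "gcd_form d \<Phi> = gcd (form d \<Phi> 0) (form d \<Phi> 1)"

definition red_form :: "nat \<Rightarrow> ratpt \<Rightarrow> 2 \<Rightarrow> complex poly poly" where
  "red_form d \<Phi> i = form d \<Phi> i div gcd_form d \<Phi>"

definition hole_mult :: "nat \<Rightarrow> ratpt \<Rightarrow> p1 \<Rightarrow> nat" where
  "hole_mult d \<Phi> x = ord_at x (gcd_form d \<Phi>)"

text \<open>The reduction as a self-map of the projective line; on \<open>Rat d\<close> it is the rational map itself.\<close>
definition reduction :: "nat \<Rightarrow> ratpt \<Rightarrow> p1 \<Rightarrow> p1" where
  "reduction d \<Phi> x = abs_cproj (\<lambda>i. eval2 (red_form d \<Phi> i) x)"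

text \<open>
  Multiplicity of \<open>x\<close> as a solution of \<open>\<phi>(x) = y\<close>, where \<open>\<phi> = P / Q\<close> is the reduction: the order
  of vanishing at \<open>x\<close> of \<open>y\<^sub>1 P - y\<^sub>0 Q\<close>.
\<close>
definition fibre_mult :: "nat \<Rightarrow> ratpt \<Rightarrow> p1 \<Rightarrow> p1 \<Rightarrow> nat" where
  "fibre_mult d \<Phi> y x =
     ord_at x (smult [:rep_cproj y 1:] (red_form d \<Phi> 0) - smult [:rep_cproj y 0:] (red_form d \<Phi> 1))"

definition meromorphic_family :: "nat \<Rightarrow> complex set \<Rightarrow> (complex \<Rightarrow> ratpt) \<Rightarrow> bool" where
  "meromorphic_family d U f \<longleftrightarrow>
     holomorphic_to_proj U f \<and> f ` U \<subseteq> Rat_bar d \<and> \<not> f ` U \<subseteq> bd_Rat d"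

text \<open>
  Postcomposition \<open>A \<circ> \<Phi>\<close> of \<open>\<Phi> = (P, Q)\<close> with \<open>A \<in> Rat_bar 1\<close>; the \<open>i\<close>-th form of \<open>A\<close> is
  \<open>a\<^sub>i\<^sub>1 x + a\<^sub>i\<^sub>0 y\<close>.
\<close>
definition moebius_comp :: "ratpt \<Rightarrow> ratpt \<Rightarrow> ratpt" where
  "moebius_comp A \<Phi> = abs_cproj (\<lambda>(i, j).
     rep_cproj A (i, 1) * rep_cproj \<Phi> (0, j) + rep_cproj A (i, 0) * rep_cproj \<Phi> (1, j))"


section \<open>Pullback of measures and the measure of maximal entropy\<close>

definition fun_push :: "nat \<Rightarrow> ratpt \<Rightarrow> (p1 \<Rightarrow> real) \<Rightarrow> p1 \<Rightarrow> real" where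
  "fun_push d \<Phi> \<psi> y = (\<Sum>x | reduction d \<Phi> x = y. real (fibre_mult d \<Phi> y x) * \<psi> x)"

text \<open>\<open>\<phi>\<^sup>*\<nu>\<close>, by the duality \<open>\<integral>\<psi> d(\<phi>\<^sup>*\<nu>) = \<integral>\<phi>\<^sub>*\<psi> d\<nu>\<close> for indicator functions \<open>\<psi>\<close> of Borel sets.\<close>
definition red_pullback :: "nat \<Rightarrow> ratpt \<Rightarrow> p1 measure \<Rightarrow> p1 measure" where
  "red_pullback d \<Phi> \<nu> = measure_of UNIV (sets borel)
     (\<lambda>B. \<integral>\<^sup>+ y. ennreal (fun_push d \<Phi> (indicat_real B) y) \<partial>\<nu>)"

text \<open>\<open>\<phi>\<^sup>*\<nu> + (\<Sum>x. s(x) \<delta>\<^sub>x)\<close>\<close>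
definition pullback :: "nat \<Rightarrow> ratpt \<Rightarrow> p1 measure \<Rightarrow> p1 measure" where
  "pullback d \<Phi> \<nu> = measure_of UNIV (sets borel)
     (\<lambda>B. emeasure (red_pullback d \<Phi> \<nu>) B +
          (\<Sum>x | hole_mult d \<Phi> x \<noteq> 0. of_nat (hole_mult d \<Phi> x) * indicator B x))"

definition exceptional :: "(p1 \<Rightarrow> p1) \<Rightarrow> p1 \<Rightarrow> bool" where
  "exceptional \<phi> x \<longleftrightarrow> finite (\<Union>n. (\<phi> ^^ n) -` {x})"

definition max_entropy_measure :: "nat \<Rightarrow> ratpt \<Rightarrow> p1 measure \<Rightarrow> bool" where
  "max_entropy_measure d \<Phi> \<mu> \<longleftrightarrow>
     prob_space \<mu> \<and> sets \<mu> = sets borel \<and>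
     scale_measure (ennreal (1 / real d)) (red_pullback d \<Phi> \<mu>) = \<mu> \<and>
     (\<forall>x. exceptional (reduction d \<Phi>) x \<longrightarrow> emeasure \<mu> {x} = 0)"


section \<open>The surfaces and weak limits\<close>

text \<open>
  Surfaces are fibred over the disk of radius \<open>r\<close> by their first coordinate.
\<close>
definition surface_X :: "real \<Rightarrow> (complex \<times> p1) set" where
  "surface_X r = ball 0 r \<times> UNIV"

definition surface_Y :: "real \<Rightarrow> (complex \<Rightarrow> ratpt) \<Rightarrow> (complex \<times> p1 \<times> p1) set" where
  "surface_Y r A =
     closure {(t, z, w). t \<in> ball 0 r - {0} \<and> w = reduction 1 (A t) z} \<inter> (ball 0 r \<times> UNIV)"

definition central_fibre :: "(complex \<times> 'z) set \<Rightarrow> (complex \<times> 'z) set" where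
  "central_fibre Y = {p \<in> Y. fst p = 0}"

text \<open>
  The projection \<open>\<pi>\<^sub>E\<close> of the central fibre \<open>C\<^sub>0 \<union> E\<^sub>0\<close> onto \<open>E\<^sub>0\<close>, in the coordinate \<open>w\<close> of \<open>E\<^sub>0\<close>:
  \<open>E\<^sub>0 = {(0, z\<^sub>0)} \<times> P\<^sup>1\<close> for some \<open>z\<^sub>0\<close>, while \<open>w\<close> is constant on \<open>C\<^sub>0\<close>.
\<close>
definition proj_E :: "complex \<times> p1 \<times> p1 \<Rightarrow> p1" where
  "proj_E = (\<lambda>(t, z, w). w)"

definition proj_X :: "complex \<times> p1 \<times> p1 \<Rightarrow> complex \<times> p1" where
  "proj_X = (\<lambda>(t, z, w). (t, z))"

text \<open>
  \<open>\<mu>\<^sub>0\<close> is a Borel measure on the central fibre of \<open>Y\<close>; \<open>\<iota> t\<close> identifies \<open>P\<^sup>1\<close> with the fibre of \<open>Y\<close>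
  over \<open>t \<noteq> 0\<close>.
\<close>
definition weak_limit ::
  "real \<Rightarrow> (complex \<times> 'z::topological_space) set \<Rightarrow> (complex \<Rightarrow> p1 \<Rightarrow> complex \<times> 'z) \<Rightarrow>
   (complex \<Rightarrow> p1 measure) \<Rightarrow> (complex \<times> 'z) measure \<Rightarrow> bool" where
  "weak_limit r Y \<iota> \<mu> \<mu>\<^sub>0 \<longleftrightarrow>
     sets \<mu>\<^sub>0 = sets (restrict_space borel (central_fibre Y)) \<and>
     (\<exists>t :: nat \<Rightarrow> complex. (\<forall>n. t n \<in> ball 0 r - {0}) \<and> t \<longlonglongrightarrow> 0 \<and>
        (\<forall>\<psi> :: complex \<times> 'z \<Rightarrow> real. continuous_on Y \<psi> \<longrightarrow>
           (\<lambda>n. \<integral>z. \<psi> (\<iota> (t n) z) \<partial>\<mu> (t n)) \<longlonglongrightarrow> (\<integral>p. \<psi> p \<partial>\<mu>\<^sub>0)))"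

end

theory Submission
  imports Defs "HOL-Computational_Algebra.Fundamental_Theorem_Algebra"
begin

text \<open>
Let \<open>\<Phi> = (P, Q)\<close> be a pair of binary forms of degree \<open>d\<close> and \<open>y = [y\<^sub>0 : y\<^sub>1]\<close> a point of the
  projective line. Everything rests on the binary form \<open>y\<^sub>1 P - y\<^sub>0 Q\<close>, the member of the \<^emph>\<open>pencil\<close>
  of \<open>\<Phi>\<close> at \<open>y\<close>. If \<open>\<Phi>\<close> is a rational function of degree \<open>d\<close>, its zeros are the \<open>d\<close> preimages of
  \<open>y\<close>. If \<open>\<Phi>\<close> is degenerate, the common factor \<open>H = gcd P Q\<close> splits off, and the zeros are the holes,
  that is the zeros of \<open>H\<close>, together with the preimages of \<open>y\<close> under the reduction
  (\<open>zeros_pencil\<close>, \<open>fun_push_eq_zero_sum\<close>). Thus for a probability measure \<open>\<nu>\<close> the degenerate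
  pullback \<open>\<phi>\<^sup>*\<nu> + (\<Sum>x. s(x) \<delta>\<^sub>x)\<close> is nothing but the integral over \<open>\<nu>\<close> of the counting measures of the
  zeros of the pencil (\<open>pullback_eq_kernel_measure\<close>), by the same formula as for \<open>\<Phi>\<close> nondegenerate.

  The zeros of a nonzero form, with multiplicities, depend continuously on the coefficients
  (\<open>continuous_on_zero_sum\<close>): every form of degree \<open>n\<close> is a product of \<open>n\<close> linear forms, the roots
  range over a compact space, and a limit of factorizations is a factorization of the limit. All
  members of the pencil of \<open>\<Phi>\<close> are nonzero as soon as the reduction of \<open>\<Phi>\<close> is not constant
  (\<open>nonconst_reduction\<close>). So if \<open>h t\<close> is a continuous family of pairs with nonconstant reductions and
  \<open>\<psi>\<close> is a continuous function on the projective line, the sum of \<open>\<psi>\<close> over the zeros of the member at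
  \<open>y\<close> of the pencil of \<open>h t\<close> is jointly continuous in \<open>t\<close> and \<open>y\<close>, also at the degenerate parameter
  (\<open>continuous_on_zero_sum_pencil\<close>).

  Take \<open>h t = A\<^sub>t \<circ> f\<^sub>t\<close> for \<open>t \<noteq> 0\<close> and \<open>h 0 = \<Phi>\<close>. Postcomposition with \<open>A\<^sub>t\<close> merely reparametrizes the
  pencil: its member at \<open>A\<^sub>t(z)\<close> is proportional to the member at \<open>z\<close> of the pencil of \<open>f\<^sub>t\<close>
  (\<open>zeros_pencil_moebius_comp\<close>). Hence, in the coordinate \<open>w = A\<^sub>t(z)\<close> of \<open>Y\<close>, the above sums form a
  continuous function on \<open>Y\<close> which restricts to \<open>(f\<^sub>t)\<^sub>*\<psi>\<close> on the fibre over \<open>t \<noteq> 0\<close>, where its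
  integral is \<open>d \<integral>\<psi> d\<mu>\<^sub>t\<close> by the invariance of \<open>\<mu>\<^sub>t\<close>, and which on the central fibre is the function
  that is integrated to obtain the pullback of \<open>\<mu>\<^sub>0\<close>. Weak convergence turns the invariance of \<open>\<mu>\<^sub>t\<close>
  into the claimed identity, tested against \<open>\<psi>\<close> (\<open>weak_limit_pullback\<close>). Finally, continuous functions
  determine a finite Borel measure on the projective line, since the indicator functions of closed
  sets are pointwise limits of them (\<open>closed_p1_approx\<close>, \<open>pullback_eqI\<close>).
\<close>

section \<open>The topology of projective space\<close>

lemma rep_cproj_nonzero: "\<exists>i. rep_cproj x i \<noteq> 0"
  using Quotient_rep_reflp[OF Quotient_cproj, of x] by (auto simp: proj_rel_def)

lemma abs_rep_cproj [simp]: "abs_cproj (rep_cproj x) = x"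
  by (rule Quotient_abs_rep[OF Quotient_cproj])

lemma proj_rel_scale: "\<exists>i. u i \<noteq> 0 \<Longrightarrow> c \<noteq> 0 \<Longrightarrow> proj_rel u (\<lambda>i. c * u i)"
  by (auto simp: proj_rel_def)

lemma abs_cproj_scale: "\<exists>i. u i \<noteq> 0 \<Longrightarrow> c \<noteq> 0 \<Longrightarrow> abs_cproj (\<lambda>i. c * u i) = abs_cproj u"
  by (metis Quotient_rel_abs[OF Quotient_cproj] proj_rel_scale)

lemma rep_abs_cproj:
  assumes "\<exists>i. u i \<noteq> 0"
  obtains c where "c \<noteq> 0" "rep_cproj (abs_cproj u) = (\<lambda>i. c * u i)"
proof -
  have "proj_rel u u" using proj_rel_scale[OF assms, of 1] by simp
  then have "proj_rel u (rep_cproj (abs_cproj u))"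
    using Quotient_rep_abs[OF Quotient_cproj] part_equivp_symp[OF part_equivp_proj_rel] by metis
  then show ?thesis using that by (auto simp: proj_rel_def)
qed

lemma abs_cproj_eqD:
  assumes "abs_cproj u = abs_cproj v" "\<exists>i. u i \<noteq> 0" "\<exists>i. v i \<noteq> 0"
  obtains c where "c \<noteq> 0" "v = (\<lambda>i. c * u i)"
proof -
  obtain a b where "a \<noteq> 0" "b \<noteq> 0" "(\<lambda>i. a * u i) = (\<lambda>i. b * v i)"
    using rep_abs_cproj[OF assms(2)] rep_abs_cproj[OF assms(3)] assms(1) by metis
  then have "v = (\<lambda>i. (a / b) * u i)" by (auto simp: fun_eq_iff field_simps)
  with \<open>a \<noteq> 0\<close> \<open>b \<noteq> 0\<close> show ?thesis using that[of "a / b"] by simp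
qed

lemma open_nonzero: "open {v :: 'i \<Rightarrow> complex. \<exists>i. v i \<noteq> 0}"
proof -
  have "{v :: 'i \<Rightarrow> complex. \<exists>i. v i \<noteq> 0} = (\<Union>i. (\<lambda>v. v i) -` (- {0}))" by auto
  moreover have "open ((\<lambda>v :: 'i \<Rightarrow> complex. v i) -` (- {0}))" for i
    by (rule open_vimage) (auto intro: continuous_on_product_coordinates)
  ultimately show ?thesis by (simp add: open_UN)
qed

lemma continuous_on_abs_cproj: "continuous_on {v. \<exists>i. v i \<noteq> 0} abs_cproj"
  unfolding continuous_on_open_vimage[OF open_nonzero]
  by (auto simp: open_cproj_def vimage_def Int_def conj_commute)

text \<open>
  The universal property of the quotient topology.
\<close>
lemma continuous_on_cproj:
  fixes f :: "'i cproj \<Rightarrow> 'b::topological_space"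
  assumes "continuous_on {v. \<exists>i. v i \<noteq> 0} (\<lambda>v. f (abs_cproj v))"
  shows "continuous_on UNIV f"
proof -
  have "open (f -` B)" if "open B" for B
    using assms that unfolding continuous_on_open_vimage[OF open_nonzero] open_cproj_def
    by (auto simp: vimage_def Int_def conj_commute)
  then show ?thesis by (simp add: continuous_on_open_vimage)
qed

text \<open>
  The affine chart \<open>rep_cproj x i \<noteq> 0\<close>. It does not depend on the choice of homogeneous coordinates,
  and serves as a continuous local replacement for the discontinuous \<open>rep_cproj\<close>.
\<close>
definition chart :: "'i \<Rightarrow> 'i cproj \<Rightarrow> 'i \<Rightarrow> complex" where
  "chart i x = (\<lambda>j. rep_cproj x j / rep_cproj x i)"

lemma chart_abs_cproj:
  assumes "v i \<noteq> 0"
  shows "chart i (abs_cproj v) = (\<lambda>j. v j / v i)"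
proof -
  obtain c where "c \<noteq> 0" "rep_cproj (abs_cproj v) = (\<lambda>i. c * v i)"
    using rep_abs_cproj assms by metis
  then show ?thesis by (auto simp: chart_def)
qed

lemma open_chart_domain: "open {x. rep_cproj x i \<noteq> 0}"
proof -
  have "rep_cproj (abs_cproj v) i \<noteq> 0 \<longleftrightarrow> v i \<noteq> 0" if "\<exists>i. v i \<noteq> 0" for v
    using rep_abs_cproj[OF that] by (metis mult_eq_0_iff)
  then have "{v. (\<exists>i. v i \<noteq> 0) \<and> abs_cproj v \<in> {x. rep_cproj x i \<noteq> 0}} = {v. v i \<noteq> 0}"
    by auto
  also have "open \<dots>"
    by (intro open_Collect_neq continuous_intros continuous_on_product_coordinates)
  finally show ?thesis unfolding open_cproj_def .
qed

lemma continuous_on_chart: "continuous_on {x. rep_cproj x i \<noteq> 0} (chart i)"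
  unfolding continuous_on_open_vimage[OF open_chart_domain]
proof (intro allI impI)
  fix B :: "('a \<Rightarrow> complex) set" assume B: "open B"
  have op: "open {v :: 'a \<Rightarrow> complex. v i \<noteq> 0}"
    by (intro open_Collect_neq continuous_intros continuous_on_product_coordinates)
  have "continuous_on {v :: 'a \<Rightarrow> complex. v i \<noteq> 0} (\<lambda>v j. v j / v i)"
    by (intro continuous_on_coordinatewise_then_product continuous_on_divide
        continuous_on_product_coordinates continuous_on_subset[OF continuous_on_product_coordinates]) auto
  then have "open ((\<lambda>v j. v j / v i) -` B \<inter> {v :: 'a \<Rightarrow> complex. v i \<noteq> 0})"
    using B unfolding continuous_on_open_vimage[OF op] by blast
  also have "(\<lambda>v j. v j / v i) -` B \<inter> {v :: 'a \<Rightarrow> complex. v i \<noteq> 0} =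
      {v. (\<exists>i. v i \<noteq> 0) \<and> abs_cproj v \<in> chart i -` B \<inter> {x. rep_cproj x i \<noteq> 0}}"
  proof (intro set_eqI)
    fix v :: "'a \<Rightarrow> complex"
    have *: "(\<exists>i. v i \<noteq> 0) \<and> rep_cproj (abs_cproj v) i \<noteq> 0 \<longleftrightarrow> v i \<noteq> 0"
      using rep_abs_cproj[of v] by (metis mult_eq_0_iff)
    show "v \<in> (\<lambda>v j. v j / v i) -` B \<inter> {v. v i \<noteq> 0} \<longleftrightarrow>
        v \<in> {v. (\<exists>i. v i \<noteq> 0) \<and> abs_cproj v \<in> chart i -` B \<inter> {x. rep_cproj x i \<noteq> 0}}"
    proof (cases "v i = 0")
      case True
      then show ?thesis using * by blast
    next
      case False
      then show ?thesis using * chart_abs_cproj[where v = v and i = i] False by auto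
    qed
  qed
  finally show "open (chart i -` B \<inter> {x. rep_cproj x i \<noteq> 0})" unfolding open_cproj_def .
qed

lemma tendsto_fun_iff:
  fixes f :: "'a \<Rightarrow> 'i \<Rightarrow> 'b::topological_space"
  shows "(f \<longlongrightarrow> l) F \<longleftrightarrow> (\<forall>i. ((\<lambda>x. f x i) \<longlongrightarrow> l i) F)"
  using limitin_componentwise[of "\<lambda>_. euclidean" UNIV f l F]
  by (simp add: euclidean_product_topology flip: limitin_canonical_iff)

lemma tendsto_abs_cproj:
  assumes "(g \<longlongrightarrow> u) F" "\<exists>i. u i \<noteq> 0"
  shows "((\<lambda>s. abs_cproj (g s)) \<longlongrightarrow> abs_cproj u) F" "\<forall>\<^sub>F s in F. \<exists>i. g s i \<noteq> 0"
proof -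
  show ev: "\<forall>\<^sub>F s in F. \<exists>i. g s i \<noteq> 0"
    using topological_tendstoD[OF assms(1) open_nonzero] assms(2) by simp
  show "((\<lambda>s. abs_cproj (g s)) \<longlongrightarrow> abs_cproj u) F"
    by (rule continuous_on_tendsto_compose[OF continuous_on_abs_cproj assms(1)]) (use assms(2) ev in simp_all)
qed

lemma tendsto_chart:
  assumes "(f \<longlongrightarrow> x) F" "rep_cproj x i \<noteq> 0"
  shows "((\<lambda>s. chart i (f s)) \<longlongrightarrow> chart i x) F" "\<forall>\<^sub>F s in F. rep_cproj (f s) i \<noteq> 0"
proof -
  show ev: "\<forall>\<^sub>F s in F. rep_cproj (f s) i \<noteq> 0"
    using topological_tendstoD[OF assms(1) open_chart_domain, of i] assms(2) by simp
  show "((\<lambda>s. chart i (f s)) \<longlongrightarrow> chart i x) F"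
    by (rule continuous_on_tendsto_compose[OF continuous_on_chart assms(1)]) (use assms(2) ev in simp_all)
qed

lemma continuous_on_holomorphic_to_proj:
  assumes "holomorphic_to_proj U f" shows "continuous_on U f"
  unfolding continuous_on_def
proof
  fix t assume "t \<in> U"
  then obtain V g where V: "open V" "t \<in> V" "\<And>i. (\<lambda>s. g s i) holomorphic_on V"
    "\<And>s. s \<in> V \<Longrightarrow> (\<exists>i. g s i \<noteq> 0) \<and> f s = abs_cproj (g s)"
    using assms unfolding holomorphic_to_proj_def by metis
  have "((\<lambda>s. g s i) \<longlongrightarrow> g t i) (at t)" for i
    using holomorphic_on_imp_continuous_on[OF V(3)[of i]] V(1,2) 
    by (simp add: continuous_on_eq_continuous_at isCont_def)
  then have "((\<lambda>s. abs_cproj (g s)) \<longlongrightarrow> abs_cproj (g t)) (at t)"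
    using V(2,4) by (intro tendsto_abs_cproj) (auto simp: tendsto_fun_iff)
  moreover have "\<forall>\<^sub>F s in at t. abs_cproj (g s) = f s"
    using eventually_at_in_open'[OF V(1,2)] by eventually_elim (use V(4) in simp)
  ultimately have "(f \<longlongrightarrow> abs_cproj (g t)) (at t)" by (rule Lim_transform_eventually)
  then show "(f \<longlongrightarrow> f t) (at t within U)"
    using V(4)[OF V(2)] by (auto intro: Lim_at_imp_Lim_at_within)
qed

lemma exhaust_0_1: "(i :: 2) = 0 \<or> i = 1"
  using exhaust_2[of i] by auto

lemma ex_2: "(\<exists>i::2. P i) \<longleftrightarrow> P 0 \<or> P 1"
proof
  assume "\<exists>i. P i"
  then obtain i where "P i" ..
  then show "P 0 \<or> P 1" using exhaust_0_1[of i] by auto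
qed auto

definition vec2 :: "'a \<times> 'a \<Rightarrow> 2 \<Rightarrow> 'a" where
  "vec2 p = (\<lambda>i. if i = 0 then fst p else snd p)"

lemma vec2_simps [simp]: "vec2 p 0 = fst p" "vec2 p 1 = snd p"
  by (auto simp: vec2_def)

lemma vec2_nonzero: "(\<exists>i. vec2 p i \<noteq> 0) \<longleftrightarrow> p \<noteq> (0 :: complex \<times> complex)"
  unfolding ex_2 by (simp add: prod_eq_iff)

lemma continuous_on_vec2: "continuous_on S vec2"
  unfolding vec2_def
proof (rule continuous_on_coordinatewise_then_product)
  fix i :: 2
  show "continuous_on S (\<lambda>x :: 'a \<times> 'a. if i = 0 then fst x else snd x)"
    by (cases "i = 0") (auto intro: continuous_intros)
qed

lemma continuous_on_abs_vec2: "continuous_on (sphere 0 1) (\<lambda>p :: complex \<times> complex. abs_cproj (vec2 p))"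
  by (rule continuous_on_compose2[OF continuous_on_abs_cproj continuous_on_vec2])
     (auto simp: vec2_nonzero simp del: ex_simps)

text \<open>
  Unit vectors make the space of homogeneous coordinates compact; this is what both the compactness
  of the projective line and the convergence of roots are drawn from.
\<close>
lemma p1_unit_rep:
  obtains p :: "complex \<times> complex" where "p \<in> sphere 0 1" "x = abs_cproj (vec2 p)"
proof -
  define q where "q = (rep_cproj x 0, rep_cproj x 1)"
  have q: "vec2 q = rep_cproj x"
  proof
    fix i show "vec2 q i = rep_cproj x i" using exhaust_0_1[of i] by (auto simp: q_def)
  qed
  then have "q \<noteq> 0" using rep_cproj_nonzero[of x] vec2_nonzero[of q] by simp
  moreover have "vec2 (q /\<^sub>R norm q) = (\<lambda>i. of_real (inverse (norm q)) * vec2 q i)"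
    by (auto simp: vec2_def fun_eq_iff scaleR_conv_of_real)
  ultimately have "abs_cproj (vec2 (q /\<^sub>R norm q)) = x"
    using abs_cproj_scale[of "vec2 q" "of_real (inverse (norm q))"] vec2_nonzero[of q] q by simp
  moreover have "q /\<^sub>R norm q \<in> sphere 0 1" using \<open>q \<noteq> 0\<close> by simp
  ultimately show ?thesis using that by metis
qed

lemma compact_UNIV_p1: "compact (UNIV :: p1 set)"
proof -
  have "compact ((\<lambda>p :: complex \<times> complex. abs_cproj (vec2 p)) ` sphere 0 1)"
    by (rule compact_continuous_image[OF continuous_on_abs_vec2]) simp
  also have "(\<lambda>p :: complex \<times> complex. abs_cproj (vec2 p)) ` sphere 0 1 = UNIV"
  proof -
    have "x \<in> (\<lambda>p :: complex \<times> complex. abs_cproj (vec2 p)) ` sphere 0 1" for x :: p1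
      by (rule p1_unit_rep[of x]) blast
    then show ?thesis by blast
  qed
  finally show ?thesis .
qed

text \<open>
  The matrix of the orthogonal projection onto the line spanned by \<open>v\<close>. It depends on the line only,
  and embeds the projective line into a metric space.
\<close>
definition proj_matrix :: "(2 \<Rightarrow> complex) \<Rightarrow> 2 \<times> 2 \<Rightarrow> complex" where
  "proj_matrix v = (\<lambda>(i, j). v i * cnj (v j) / of_real ((cmod (v 0))\<^sup>2 + (cmod (v 1))\<^sup>2))"

lemma nonzero_norm_pos: "\<exists>i::2. v i \<noteq> 0 \<Longrightarrow> (cmod (v 0))\<^sup>2 + (cmod (v 1))\<^sup>2 > 0"
  unfolding ex_2 by (auto intro: add_pos_nonneg add_nonneg_pos)

lemma proj_matrix_scale:
  assumes "c \<noteq> 0" shows "proj_matrix (\<lambda>i. c * v i) = proj_matrix v"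
proof -
  define N where "N = complex_of_real ((cmod (v 0))\<^sup>2 + (cmod (v 1))\<^sup>2)"
  have N: "complex_of_real ((cmod (c * v 0))\<^sup>2 + (cmod (c * v 1))\<^sup>2) = (c * cnj c) * N"
    unfolding N_def of_real_add complex_norm_square by (simp add: algebra_simps)
  have "(c * a) * cnj (c * b) / ((c * cnj c) * N) = a * cnj b / N" for a b
    using assms by simp
  then show ?thesis unfolding proj_matrix_def N by (simp add: N_def)
qed

lemma continuous_on_proj_matrix: "continuous_on UNIV (\<lambda>x. proj_matrix (rep_cproj x))"
proof (rule continuous_on_cproj)
  have "continuous_on {v :: 2 \<Rightarrow> complex. \<exists>i. v i \<noteq> 0} proj_matrix"
  proof (rule continuous_on_coordinatewise_then_product)
    fix ij :: "2 \<times> 2"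
    obtain i j where ij: "ij = (i, j)" by (cases ij)
    have "complex_of_real ((cmod (v 0))\<^sup>2 + (cmod (v 1))\<^sup>2) \<noteq> 0" if "\<exists>i. v i \<noteq> 0" for v :: "2 \<Rightarrow> complex"
      using nonzero_norm_pos[OF that] unfolding of_real_eq_0_iff by linarith
    then have "continuous_on {v :: 2 \<Rightarrow> complex. \<exists>i. v i \<noteq> 0}
        (\<lambda>v. v i * cnj (v j) / of_real ((cmod (v 0))\<^sup>2 + (cmod (v 1))\<^sup>2))"
      by (intro continuous_intros continuous_on_subset[OF continuous_on_product_coordinates]) (auto simp del: of_real_power of_real_add)
    then show "continuous_on {v :: 2 \<Rightarrow> complex. \<exists>i. v i \<noteq> 0} (\<lambda>x. proj_matrix x ij)"
      by (simp add: proj_matrix_def ij)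
  qed
  moreover have "proj_matrix (rep_cproj (abs_cproj v)) = proj_matrix v" if "\<exists>i. v i \<noteq> 0" for v
    by (rule rep_abs_cproj[OF that]) (simp add: proj_matrix_scale)
  ultimately show "continuous_on {v :: 2 \<Rightarrow> complex. \<exists>i. v i \<noteq> 0}
      (\<lambda>v. proj_matrix (rep_cproj (abs_cproj v)))"
    by (subst continuous_on_cong[OF refl, of _ _ proj_matrix]) auto
qed

lemma inj_proj_matrix: "inj (\<lambda>x. proj_matrix (rep_cproj x))"
proof (rule injI)
  fix x y :: p1
  define u v where "u = rep_cproj x" and "v = rep_cproj y"
  define a b where "a = complex_of_real ((cmod (u 0))\<^sup>2 + (cmod (u 1))\<^sup>2)"
    and "b = complex_of_real ((cmod (v 0))\<^sup>2 + (cmod (v 1))\<^sup>2)"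
  have uv: "\<exists>i. u i \<noteq> 0" "\<exists>i. v i \<noteq> 0" using rep_cproj_nonzero by (auto simp: u_def v_def)
  have "a \<noteq> 0"
    using nonzero_norm_pos[OF uv(1)] unfolding a_def of_real_eq_0_iff by linarith
  moreover have "b \<noteq> 0"
    using nonzero_norm_pos[OF uv(2)] unfolding b_def of_real_eq_0_iff by linarith
  ultimately have ab: "a \<noteq> 0" "b \<noteq> 0" .
  assume "proj_matrix (rep_cproj x) = proj_matrix (rep_cproj y)"
  then have eq: "u i * cnj (u j) / a = v i * cnj (v j) / b" for i j
    by (auto simp: proj_matrix_def u_def v_def a_def b_def fun_eq_iff)
  obtain j where j: "u j \<noteq> 0" using uv by blast
  then have "v j \<noteq> 0" using eq[of j j] ab by auto
  have "v = (\<lambda>i. (b * cnj (u j) / (a * cnj (v j))) * u i)"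
    using eq[of _ j] ab \<open>v j \<noteq> 0\<close> by (auto simp: fun_eq_iff field_simps)
  moreover have "b * cnj (u j) / (a * cnj (v j)) \<noteq> 0" using ab j \<open>v j \<noteq> 0\<close> by simp
  ultimately have "abs_cproj v = abs_cproj u"
    using abs_cproj_scale[OF uv(1)] by metis
  then show "x = y" by (simp add: u_def v_def)
qed

text \<open>
  In the metric induced by \<open>proj_matrix\<close>, the functions \<open>max 0 (1 - n dist(x, C))\<close> decrease to the
  indicator function of \<open>C\<close>.
\<close>
lemma closed_p1_approx:
  fixes C :: "p1 set"
  assumes "closed C"
  obtains \<psi> :: "nat \<Rightarrow> p1 \<Rightarrow> real" where
    "\<And>n. continuous_on UNIV (\<psi> n)" "\<And>n x. 0 \<le> \<psi> n x" "\<And>n x. \<psi> n x \<le> 1"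
    "\<And>x. (\<lambda>n. \<psi> n x) \<longlonglongrightarrow> indicat_real C x"
proof (cases "C = {}")
  case True
  then show ?thesis using that[of "\<lambda>_ _. 0"] by simp
next
  case False
  define e where "e = (\<lambda>x :: p1. proj_matrix (rep_cproj x))"
  have e: "continuous_on S e" for S
    unfolding e_def using continuous_on_proj_matrix continuous_on_subset by blast
  have "compact C" using compact_UNIV_p1 assms by (metis compact_Int_closed Int_UNIV_left)
  then have "closed (e ` C)" using compact_continuous_image[OF e] compact_imp_closed by blast
  \<comment> \<open>Closedness of the image is needed to separate it from the points outside; it comes from compactness.\<close>
  then have mem: "infdist (e x) (e ` C) = 0 \<longleftrightarrow> x \<in> C" for x
    using in_closed_iff_infdist_zero[of "e ` C" "e x"] False inj_proj_matrix
    by (auto simp: e_def inj_def)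
  define \<psi> where "\<psi> = (\<lambda>(n::nat) x. max 0 (1 - real n * infdist (e x) (e ` C)))"
  have "(\<lambda>n. \<psi> n x) \<longlonglongrightarrow> indicat_real C x" for x
  proof (cases "x \<in> C")
    case True
    then show ?thesis using mem[of x] by (simp add: \<psi>_def)
  next
    case False
    define \<delta> where "\<delta> = infdist (e x) (e ` C)"
    have "\<delta> > 0" using mem[of x] False infdist_nonneg[of "e x" "e ` C"] unfolding \<delta>_def by linarith
    then obtain N where N: "real N * \<delta> > 1" using reals_Archimedean3 by blast
    have "\<psi> n x = 0" if "n \<ge> N" for n
    proof -
      have "real N * \<delta> \<le> real n * \<delta>" using that \<open>\<delta> > 0\<close> by simp
      then show ?thesis using N by (simp add: \<psi>_def \<delta>_def)
    qed
    then have "eventually (\<lambda>n. \<psi> n x = 0) sequentially"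
      unfolding eventually_sequentially by blast
    then show ?thesis using False by (simp add: tendsto_eventually)
  qed
  moreover have "continuous_on UNIV (\<psi> n)" for n
    unfolding \<psi>_def by (intro continuous_intros e)
  ultimately show ?thesis
    using that[of \<psi>] by (auto simp: \<psi>_def infdist_nonneg)
qed

section \<open>Binary forms and their zeros\<close>

text \<open>
  The same normal form as in \<open>form\<close>: \<open>c j\<close> is the coefficient of \<open>x\<^sup>j y\<^bsup>n-j\<^esup>\<close>.
\<close>
definition hform :: "nat \<Rightarrow> (nat \<Rightarrow> complex) \<Rightarrow> complex poly poly" where
  "hform n c = (\<Sum>j\<le>n. monom (monom (c j) j) (n - j))"

lemma form_eq_hform: "form d \<Phi> i = hform d (\<lambda>j. rep_cproj \<Phi> (i, j))"
  by (simp add: form_def hform_def)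

text \<open>
  The linear form that vanishes at the point with homogeneous coordinates \<open>u\<close>; unlike \<open>lin_form\<close> it
  varies continuously with its argument.
\<close>
definition lin :: "(2 \<Rightarrow> complex) \<Rightarrow> complex poly poly" where
  "lin u = [: [:0, u 1:], [:- u 0:] :]"

lemma lin_form_eq_lin: "lin_form x = lin (rep_cproj x)"
  by (simp add: lin_form_def lin_def)

lemma coeff_hform: "coeff (coeff (hform n c) a) b = (if a + b = n then c b else 0)"
proof -
  have "coeff (coeff (hform n c) a) b = (\<Sum>j\<le>n. if j = b then (if a + b = n then c b else 0) else 0)"
    unfolding hform_def coeff_sum by (intro sum.cong) auto
  also have "\<dots> = (if a + b = n then c b else 0)"
    by (subst sum.delta) auto
  finally show ?thesis .
qed

lemma hform_eq_iff: "hform n c = hform n c' \<longleftrightarrow> (\<forall>j\<le>n. c j = c' j)"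
proof
  assume eq: "hform n c = hform n c'"
  show "\<forall>j\<le>n. c j = c' j"
  proof (intro allI impI)
    fix j assume "j \<le> n"
    then show "c j = c' j"
      using arg_cong[OF eq, of "\<lambda>G. coeff (coeff G (n - j)) j"] by (simp add: coeff_hform)
  qed
next
  assume "\<forall>j\<le>n. c j = c' j"
  then show "hform n c = hform n c'" by (auto simp: hform_def intro!: sum.cong)
qed

lemma hform_0: "hform n (\<lambda>_. 0) = 0"
  by (simp add: hform_def)

lemma hform_eq_0_iff: "hform n c = 0 \<longleftrightarrow> (\<forall>j\<le>n. c j = 0)"
  using hform_eq_iff[of n c "\<lambda>_. 0"] by (simp add: hform_0)

lemma smult_hform: "smult [:a:] (hform n c) = hform n (\<lambda>j. a * c j)"
  by (intro poly_eqI) (simp add: coeff_hform)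

lemma diff_hform: "hform n c - hform n c' = hform n (\<lambda>j. c j - c' j)"
  by (intro poly_eqI) (simp add: coeff_hform)

lemma lin_mult_hform:
  "lin u * hform n c =
     hform (Suc n) (\<lambda>j. u 1 * (if j = 0 then 0 else c (j - 1)) - u 0 * (if j \<le> n then c j else 0))"
proof (intro poly_eqI)
  fix a b
  have "lin u * G = smult [:0, u 1:] G + pCons 0 (smult [:- u 0:] G)" for G
    by (simp add: lin_def)
  then show "coeff (coeff (lin u * hform n c) a) b = coeff (coeff (hform (Suc n)
      (\<lambda>j. u 1 * (if j = 0 then 0 else c (j - 1)) - u 0 * (if j \<le> n then c j else 0))) a) b"
    by (cases a; cases b) (auto simp: coeff_hform coeff_pCons)
qed

lemma lin_scale: "lin (\<lambda>i. c * u i) = smult [:c:] (lin u)"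
  by (simp add: lin_def)

lemma lin_eq_0_iff: "lin u = 0 \<longleftrightarrow> \<not> (\<exists>i. u i \<noteq> 0)"
  unfolding ex_2 by (auto simp: lin_def)

text \<open>
  As a polynomial in \<open>y\<close>, the form has degree one and a unit as leading coefficient, unless \<open>u 0 = 0\<close>,
  where it is a multiple of the prime \<open>x\<close>.
\<close>
lemma prime_elem_lin:
  assumes "\<exists>i. u i \<noteq> 0" shows "prime_elem (lin u)"
proof (cases "u 0 = 0")
  case True
  then have "u 1 \<noteq> 0" using assms unfolding ex_2 by auto
  then have "prime_elem [:0, u 1:]" by (rule prime_elem_linear_field_poly)
  then show ?thesis using True by (simp add: lin_def prime_elem_const_poly_iff)
next
  case False
  then have "is_unit [:- u 0:]" by (simp add: is_unit_const_poly_iff dvd_field_iff)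
  then have "coprime [:0, u 1:] [:- u 0:]" by (rule is_unit_right_imp_coprime)
  then show ?thesis unfolding lin_def using False by (intro prime_elem_linear_poly) auto
qed

lemma prime_elem_lin_form: "prime_elem (lin_form x)"
  unfolding lin_form_eq_lin by (rule prime_elem_lin[OF rep_cproj_nonzero])

lemma lin_form_nonzero: "lin_form x \<noteq> 0"
  unfolding lin_form_eq_lin lin_eq_0_iff using rep_cproj_nonzero by simp

lemma abs_cproj_eq_cross:
  fixes u v :: "2 \<Rightarrow> complex"
  assumes "\<exists>i. u i \<noteq> 0" "\<exists>i. v i \<noteq> 0"
  shows "abs_cproj u = abs_cproj v \<longleftrightarrow> u 0 * v 1 = u 1 * v 0"
proof
  assume "abs_cproj u = abs_cproj v"
  then obtain c where "v = (\<lambda>i. c * u i)" using abs_cproj_eqD assms by blast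
  then show "u 0 * v 1 = u 1 * v 0" by simp
next
  assume cross: "u 0 * v 1 = u 1 * v 0"
  have cross': "u i * v j = u j * v i" for i j
    using exhaust_0_1[of i] exhaust_0_1[of j] cross by auto
  obtain i where i: "u i \<noteq> 0" using assms by blast
  have v: "v = (\<lambda>j. (v i / u i) * u j)"
  proof
    fix j show "v j = (v i / u i) * u j"
      using cross'[of i j] i by (simp add: field_simps)
  qed
  then have "v i / u i \<noteq> 0" using assms(2) by (metis mult_zero_left)
  then show "abs_cproj u = abs_cproj v" using abs_cproj_scale[OF assms(1)] v by metis
qed

lemma p1_eq_iff: "x = y \<longleftrightarrow> rep_cproj x 0 * rep_cproj y 1 = rep_cproj x 1 * rep_cproj y (0::2)"
  using abs_cproj_eq_cross[OF rep_cproj_nonzero[of x] rep_cproj_nonzero[of y]] by simp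

lemma eval2_mult: "eval2 (G * G') x = eval2 G x * eval2 G' x"
  by (simp add: eval2_def)

lemma eval2_diff: "eval2 (G - G') x = eval2 G x - eval2 G' x"
  by (simp add: eval2_def)

lemma eval2_smult: "eval2 (smult [:a:] G) x = a * eval2 G x"
  by (simp add: eval2_def)

lemma eval2_lin_form: "eval2 (lin_form y) x = 0 \<longleftrightarrow> x = y"
  by (auto simp: eval2_def lin_form_def p1_eq_iff algebra_simps)

lemma ord_at_lin_form: "ord_at x (lin_form y) = (if x = y then 1 else 0)"
proof (cases "x = y")
  case True
  then show ?thesis by (simp add: ord_at_def prime_elem_lin_form)
next
  case False
  have "\<not> lin_form x dvd lin_form y"
  proof
    assume "lin_form x dvd lin_form y"
    then obtain G where "lin_form y = lin_form x * G" by (elim dvdE)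
    then have "eval2 (lin_form y) x = 0" using eval2_lin_form[of x x] by (simp add: eval2_mult)
    then show False using False eval2_lin_form by simp
  qed
  then show ?thesis using False by (simp add: ord_at_def not_dvd_imp_multiplicity_0)
qed

text \<open>
  The members of \<open>M\<close> are the zeros of \<open>G\<close> with multiplicities. Via \<open>hform_splits\<close> and \<open>splits_dvd\<close>,
  this notion stands in for being a nonzero homogeneous form.
\<close>
definition splits :: "complex poly poly \<Rightarrow> p1 multiset \<Rightarrow> bool" where
  "splits G M \<longleftrightarrow> (\<exists>a. a \<noteq> 0 \<and> G = smult [:a:] (\<Prod>x\<in>#M. lin_form x))"

text \<open>
  For \<open>G = 0\<close> all orders vanish; otherwise only finitely many points have positive order when \<open>G\<close> is
  homogeneous, which is the case for all forms below.
\<close>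
definition zeros :: "complex poly poly \<Rightarrow> p1 multiset" where
  "zeros G = Abs_multiset (\<lambda>x. ord_at x G)"

lemma is_unit_scalar: "a \<noteq> 0 \<Longrightarrow> is_unit [:[:a:]:]" for a :: complex
  by (simp add: is_unit_const_poly_iff dvd_field_iff)

lemma is_unit_poly_polyE:
  assumes "is_unit (G :: complex poly poly)" obtains a where "a \<noteq> 0" "G = [:[:a:]:]"
  using assms by (auto simp: is_unit_poly_iff dvd_field_iff)

lemma ord_at_scale: "a \<noteq> 0 \<Longrightarrow> ord_at x (smult [:a:] G) = ord_at x G"
  using multiplicity_times_unit_right[OF is_unit_scalar, of a "lin_form x" G] by (simp add: ord_at_def)

lemma ord_at_splits:
  assumes "splits G M" shows "ord_at x G = count M x"
proof -
  have "ord_at x (\<Prod>x\<in>#M. lin_form x) = (\<Sum>y\<in>#M. if y = x then 1 else 0)"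
    unfolding ord_at_def
    by (subst prime_elem_multiplicity_prod_mset_distrib)
       (use prime_elem_lin_form ord_at_lin_form in
        \<open>auto simp: multiset.map_comp o_def ord_at_def eq_commute[of x] prime_elem_def\<close>)
  also have "\<dots> = count M x" by (simp add: sum_mset_delta)
  finally show ?thesis using assms by (auto simp: splits_def ord_at_scale)
qed

lemma zeros_splits: "splits G M \<Longrightarrow> zeros G = M"
  by (simp add: zeros_def ord_at_splits count_inverse)

lemma splits_mult: "splits G M \<Longrightarrow> splits G' M' \<Longrightarrow> splits (G * G') (M + M')"
  unfolding splits_def
proof (elim exE conjE)
  fix a a' assume "a \<noteq> 0" "a' \<noteq> 0" "G = smult [:a:] (\<Prod>x\<in>#M. lin_form x)"
    "G' = smult [:a':] (\<Prod>x\<in>#M'. lin_form x)"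
  then show "\<exists>a. a \<noteq> 0 \<and> G * G' = smult [:a:] (\<Prod>x\<in>#M + M'. lin_form x)"
    by (intro exI[of _ "a * a'"]) (simp add: mult.commute)
qed

lemma splits_scale: "splits G M \<Longrightarrow> a \<noteq> 0 \<Longrightarrow> splits (smult [:a:] G) M"
  unfolding splits_def
proof (elim exE conjE)
  fix b assume "a \<noteq> 0" "b \<noteq> 0" "G = smult [:b:] (\<Prod>x\<in>#M. lin_form x)"
  then show "\<exists>b. b \<noteq> 0 \<and> smult [:a:] G = smult [:b:] (\<Prod>x\<in>#M. lin_form x)"
    by (intro exI[of _ "a * b"]) (simp add: mult.commute)
qed

lemma splits_lin_form: "splits (lin_form x) {#x#}"
  by (auto simp: splits_def intro!: exI[of _ 1] simp flip: one_pCons)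

lemma splits_unit: "is_unit G \<Longrightarrow> splits G {#}"
  by (erule is_unit_poly_polyE) (auto simp: splits_def)

lemma splits_lin:
  assumes "\<exists>i. u i \<noteq> 0" shows "splits (lin u) {#abs_cproj u#}"
proof -
  obtain c where c: "c \<noteq> 0" "rep_cproj (abs_cproj u) = (\<lambda>i. c * u i)"
    using rep_abs_cproj[OF assms] .
  then have "lin u = smult [:1 / c:] (lin_form (abs_cproj u))"
    by (simp add: lin_form_eq_lin lin_scale flip: one_pCons)
  then show ?thesis using splits_scale[OF splits_lin_form, of "1 / c"] c by simp
qed

text \<open>
  Divisors of products of primes are products of some of the primes. In particular, divisors of
  homogeneous forms, such as the greatest common divisor of two of them, are homogeneous.
\<close>
lemma splits_dvd:
  assumes "splits G M" "H dvd G"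
  obtains N where "splits H N"
proof -
  have "H dvd (\<Prod>x\<in>#M. lin_form x) \<Longrightarrow> \<exists>N. splits H N"
  proof (induction M arbitrary: H)
    case empty
    then show ?case using splits_unit by auto
  next
    case (add x M)
    then obtain K where K: "lin_form x * (\<Prod>x\<in>#M. lin_form x) = H * K" by (auto elim: dvdE)
    have nz: "lin_form x \<noteq> 0" by (rule lin_form_nonzero)
    have "lin_form x dvd H * K" unfolding K[symmetric] by simp
    \<comment> \<open>A prime factor of \<open>H * K\<close> can be removed from one of the two factors.\<close>
    then consider H' where "H = lin_form x * H'" | K' where "K = lin_form x * K'"
      using prime_elem_dvd_multD[OF prime_elem_lin_form] by (metis dvdE)
    then show ?case
    proof cases
      case 1
      then have "H' dvd (\<Prod>x\<in>#M. lin_form x)" using K nz by (auto simp: mult.assoc)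
      then obtain N where "splits H' N" using add.IH by blast
      then show ?thesis using splits_mult[OF splits_lin_form] 1 by blast
    next
      case 2
      then have "lin_form x * (\<Prod>x\<in>#M. lin_form x) = lin_form x * (H * K')"
        using K by (simp add: ac_simps)
      then have "H dvd (\<Prod>x\<in>#M. lin_form x)" using nz by simp
      then show ?thesis using add.IH by blast
    qed
  qed
  moreover have "H dvd (\<Prod>x\<in>#M. lin_form x)"
  proof -
    obtain a where a: "a \<noteq> 0" "G = smult [:a:] (\<Prod>x\<in>#M. lin_form x)"
      using assms(1) by (auto simp: splits_def)
    then have "smult [:1 / a:] G = (\<Prod>x\<in>#M. lin_form x)" by (simp flip: one_pCons)
    then show ?thesis using dvd_smult[OF assms(2)] by metis
  qed
  ultimately show ?thesis using that by blast
qed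

lemma splits_eval2_eq_0:
  assumes "splits G M" shows "eval2 G x = 0 \<longleftrightarrow> x \<in># M"
proof -
  have "eval2 (\<Prod>x\<in>#M. lin_form x) x = 0 \<longleftrightarrow> x \<in># M"
    by (induction M) (auto simp: eval2_mult eval2_lin_form, simp add: eval2_def)
  then show ?thesis using assms by (auto simp: splits_def eval2_smult)
qed

text \<open>
  The fundamental theorem of algebra, homogenized: either the leading coefficient vanishes and the
  point at infinity is a zero, or the dehomogenized polynomial has a root.
\<close>
lemma hform_Suc_factor:
  obtains u c' where "\<exists>i. u i \<noteq> 0" "hform (Suc n) c = lin u * hform n c'"
proof (cases "c (Suc n) = 0")
  case True
  \<comment> \<open>The form \<open>lin (vec2 (-1, 0))\<close> is \<open>y\<close>.\<close>
  have "hform (Suc n) c = lin (vec2 (-1, 0)) * hform n c"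
    unfolding lin_mult_hform hform_eq_iff using True by (auto simp: le_Suc_eq)
  then show ?thesis by (rule that[rotated]) (auto intro: exI[of _ 0])
next
  case False
  define p where "p = (\<Sum>j\<le>Suc n. monom (c j) j)"
  have coeff_p: "coeff p j = (if j \<le> Suc n then c j else 0)" for j
    unfolding p_def coeff_sum by (simp add: if_distrib sum.delta cong: if_cong)
  have deg: "degree p = Suc n"
    using coeff_p False by (intro antisym degree_le le_degree) auto
  then have "\<not> constant (poly p)" by (simp add: constant_degree)
  then obtain \<alpha> where "poly p \<alpha> = 0" using fundamental_theorem_of_algebra by blast
  then obtain q where q: "p = [:- \<alpha>, 1:] * q" unfolding poly_eq_0_iff_dvd by (elim dvdE)
  have "q \<noteq> 0" using deg q by auto
  then have "degree q = n" using deg degree_mult_eq[of "[:- \<alpha>, 1:]" q] q by simp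
  then have "coeff q (Suc n) = 0" by (simp add: coeff_eq_0)
  moreover have "c j = (if j = 0 then 0 else coeff q (j - 1)) - \<alpha> * coeff q j" if "j \<le> Suc n" for j
    using coeff_p[of j] that unfolding q by (cases j) auto
  ultimately have "hform (Suc n) c = lin (vec2 (\<alpha>, 1)) * hform n (coeff q)"
    unfolding lin_mult_hform hform_eq_iff by (auto simp: le_Suc_eq)
  then show ?thesis by (rule that[rotated]) (auto intro: exI[of _ 1])
qed

lemma hform_splits:
  assumes "hform n c \<noteq> 0" obtains M where "size M = n" "splits (hform n c) M"
proof -
  have "\<exists>M. size M = n \<and> splits (hform n c) M"
    using assms
  proof (induction n arbitrary: c)
    case 0
    then have "is_unit (hform 0 c)" unfolding hform_eq_0_iff
      by (simp add: hform_def monom_0 is_unit_scalar)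
    then show ?case using splits_unit by auto
  next
    case (Suc n)
    obtain u c' where u: "\<exists>i. u i \<noteq> 0" "hform (Suc n) c = lin u * hform n c'"
      by (rule hform_Suc_factor)
    then obtain M where "size M = n" "splits (hform n c') M" using Suc by auto
    then show ?case using splits_mult[OF splits_lin[OF u(1)]] u(2)
      by (intro exI[of _ "{#abs_cproj u#} + M"]) auto
  qed
  then show ?thesis using that by blast
qed

section \<open>Continuity of the zeros of a form\<close>

text \<open>
  The sum of \<open>\<psi>\<close> over the zeros of \<open>G\<close>. It is used with real values for continuous \<open>\<psi>\<close>, and with
  extended nonnegative values for indicator functions and integrals.
\<close>
definition zero_sum :: "(p1 \<Rightarrow> 'a::semiring_1) \<Rightarrow> complex poly poly \<Rightarrow> 'a" where
  "zero_sum \<psi> G = (\<Sum>x\<in>#zeros G. \<psi> x)"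

lemma splits_prod_lin:
  fixes v :: "nat \<Rightarrow> 2 \<Rightarrow> complex"
  assumes "\<And>i. i < n \<Longrightarrow> \<exists>j. v i j \<noteq> 0"
  shows "splits (\<Prod>i<n. lin (v i)) (image_mset (\<lambda>i. abs_cproj (v i)) (mset_set {..<n}))"
  using assms
proof (induction n)
  case 0
  then show ?case using splits_unit by simp
next
  case (Suc n)
  have "splits (lin (v n) * (\<Prod>i<n. lin (v i)))
      ({#abs_cproj (v n)#} + image_mset (\<lambda>i. abs_cproj (v i)) (mset_set {..<n}))"
    using Suc by (intro splits_mult splits_lin) auto
  then show ?case by (simp add: lessThan_Suc mult.commute)
qed

lemma zero_sum_prod_lin:
  fixes v :: "nat \<Rightarrow> 2 \<Rightarrow> complex"
  assumes "\<And>i. i < n \<Longrightarrow> \<exists>j. v i j \<noteq> 0" "a \<noteq> 0"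
  shows "zero_sum \<psi> (smult [:a:] (\<Prod>i<n. lin (v i))) = (\<Sum>i<n. \<psi> (abs_cproj (v i)))"
  using zeros_splits[OF splits_scale[OF splits_prod_lin[of n v, OF assms(1)] assms(2)]]
  by (simp add: zero_sum_def multiset.map_comp o_def sum_unfold_sum_mset)

lemma hform_unit_factorization:
  assumes "hform n c \<noteq> 0"
  obtains a u where "a \<noteq> 0" "\<And>i. i < n \<Longrightarrow> u i \<in> sphere (0 :: complex \<times> complex) 1"
    "hform n c = smult [:a:] (\<Prod>i<n. lin (vec2 (u i)))"
proof -
  obtain M where M: "size M = n" "splits (hform n c) M" using hform_splits[OF assms] .
  obtain xs where xs: "mset xs = M" using ex_mset by blast
  have "\<exists>p \<in> sphere (0 :: complex \<times> complex) 1. x = abs_cproj (vec2 p)" for x :: p1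
    by (rule p1_unit_rep[of x]) blast
  then obtain R where R: "\<And>x. R x \<in> sphere (0 :: complex \<times> complex) 1" "\<And>x. abs_cproj (vec2 (R x)) = x"
    by metis
  define u where "u i = R (xs ! i)" for i
  have nz: "\<exists>j. vec2 (u i) j \<noteq> 0" for i
    unfolding vec2_nonzero u_def using R(1)[of "xs ! i"] by auto
  have "image_mset (\<lambda>i. abs_cproj (vec2 (u i))) (mset_set {..<n}) = mset (map (\<lambda>i. xs ! i) [0..<n])"
    unfolding mset_map mset_upt by (simp add: u_def R lessThan_atLeast0)
  also have "map (\<lambda>i. xs ! i) [0..<n] = xs"
    using xs M(1) map_nth[of xs] by auto
  finally have "splits (\<Prod>i<n. lin (vec2 (u i))) M"
    using splits_prod_lin[of n "\<lambda>i. vec2 (u i)"] nz xs by simp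
  then obtain a b where "a \<noteq> 0" "(\<Prod>i<n. lin (vec2 (u i))) = smult [:a:] (\<Prod>x\<in>#M. lin_form x)"
    "b \<noteq> 0" "hform n c = smult [:b:] (\<Prod>x\<in>#M. lin_form x)"
    using M(2) by (auto simp: splits_def)
  then have "b / a \<noteq> 0" "hform n c = smult [:b / a:] (\<Prod>i<n. lin (vec2 (u i)))" by auto
  then show ?thesis using that[of "b / a" u] R(1) unfolding u_def by blast
qed

lemma prod_lin_tendsto:
  assumes "\<And>i. i < n \<Longrightarrow> (\<lambda>k. U k i) \<longlonglongrightarrow> l i"
  obtains C c where "\<And>k. (\<Prod>i<n. lin (vec2 (U k i))) = hform n (C k)"
    "(\<Prod>i<n. lin (vec2 (l i))) = hform n c" "\<And>j. (\<lambda>k. C k j) \<longlonglongrightarrow> c j"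
proof -
  have "\<exists>C c. (\<forall>k. (\<Prod>i<n. lin (vec2 (U k i))) = hform n (C k)) \<and>
    (\<Prod>i<n. lin (vec2 (l i))) = hform n c \<and> (\<forall>j. (\<lambda>k. C k j) \<longlonglongrightarrow> c j)"
    using assms
  proof (induction n)
    case 0
    have "1 = hform 0 (\<lambda>_. 1)" by (simp add: hform_def monom_0 flip: one_pCons)
    then show ?case by (intro exI[of _ "\<lambda>_ _. 1"] exI[of _ "\<lambda>_. 1"]) simp
  next
    case (Suc n)
    then obtain C c where C: "\<And>k. (\<Prod>i<n. lin (vec2 (U k i))) = hform n (C k)"
      "(\<Prod>i<n. lin (vec2 (l i))) = hform n c" "\<And>j. (\<lambda>k. C k j) \<longlonglongrightarrow> c j"
      by auto
    define T :: "complex \<times> complex \<Rightarrow> (nat \<Rightarrow> complex) \<Rightarrow> nat \<Rightarrow> complex" where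
      "T p c j = snd p * (if j = 0 then 0 else c (j - 1)) - fst p * (if j \<le> n then c j else 0)"
      for p c j
    have T: "lin (vec2 p) * hform n c = hform (Suc n) (T p c)" for p c
      unfolding lin_mult_hform by (simp add: T_def[abs_def])
    have U: "(\<lambda>k. U k n) \<longlonglongrightarrow> l n" using Suc.prems by simp
    have "(\<lambda>k. T (U k n) (C k) j) \<longlonglongrightarrow> T (l n) c j" for j
      unfolding T_def by (cases "j = 0"; cases "j \<le> n") (auto intro!: tendsto_intros U C(3))
    then show ?case
      using C(1,2) T by (intro exI[of _ "\<lambda>k. T (U k n) (C k)"] exI[of _ "T (l n) c"])
        (simp add: lessThan_Suc mult.commute)
  qed
  then show ?thesis using that by blast
qed

lemma compact_finite_subseq:
  fixes U :: "nat \<Rightarrow> nat \<Rightarrow> 'a::metric_space"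
  assumes "compact S" "\<And>k i. i < n \<Longrightarrow> U k i \<in> S"
  obtains r l where "strict_mono r" "\<And>i. i < n \<Longrightarrow> l i \<in> S"
    "\<And>i. i < n \<Longrightarrow> (\<lambda>k. U (r k) i) \<longlonglongrightarrow> l i"
proof -
  have "\<exists>r l. strict_mono r \<and> (\<forall>i<n. l i \<in> S \<and> (\<lambda>k. U (r k) i) \<longlonglongrightarrow> l i)"
    using assms(2)
  proof (induction n)
    case 0
    then show ?case using strict_mono_id by auto
  next
    case (Suc n)
    then obtain r l where r: "strict_mono (r :: nat \<Rightarrow> nat)"
      "\<And>i. i < n \<Longrightarrow> l i \<in> S \<and> (\<lambda>k. U (r k) i) \<longlonglongrightarrow> l i" by auto
    obtain r' x where r': "x \<in> S" "strict_mono (r' :: nat \<Rightarrow> nat)" "((\<lambda>k. U (r k) n) \<circ> r') \<longlonglongrightarrow> x"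
      using assms(1) Suc.prems unfolding compact_def
      by (metis (no_types, lifting) lessI)
    have "(\<lambda>k. U ((r \<circ> r') k) i) \<longlonglongrightarrow> (l(n := x)) i" "(l(n := x)) i \<in> S" if "i < Suc n" for i
      using that r(2)[of i] r' LIMSEQ_subseq_LIMSEQ[OF _ r'(2), of "\<lambda>k. U (r k) i"]
      by (cases "i = n"; auto simp: o_def)+
    then show ?case using strict_mono_o[OF r(1) r'(2)] by blast
  qed
  then show ?thesis using that by blast
qed

text \<open>
  Normalize the roots to be unit vectors. A subsequence of the factorizations converges, and as the
  product of the limit factors is nonzero, it must be proportional to the limit form.
\<close>
lemma zero_sum_subseq:
  fixes \<psi> :: "p1 \<Rightarrow> real"
  assumes \<psi>: "continuous_on UNIV \<psi>"
    and lim: "\<And>j. j \<le> n \<Longrightarrow> (\<lambda>k. c k j) \<longlonglongrightarrow> c0 j"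
    and nz: "\<And>k. hform n (c k) \<noteq> 0" "hform n c0 \<noteq> 0"
  obtains r where "strict_mono r" "(\<lambda>k. zero_sum \<psi> (hform n (c (r k)))) \<longlonglongrightarrow> zero_sum \<psi> (hform n c0)"
proof -
  have "\<exists>a u. a \<noteq> 0 \<and> (\<forall>i<n. u i \<in> sphere (0 :: complex \<times> complex) 1) \<and>
    hform n (c k) = smult [:a:] (\<Prod>i<n. lin (vec2 (u i)))" for k
    by (rule hform_unit_factorization[OF nz(1)[of k]]) blast
  then obtain a U where aU: "\<And>k. a k \<noteq> 0" "\<And>k i. i < n \<Longrightarrow> U k i \<in> sphere (0 :: complex \<times> complex) 1"
    "\<And>k. hform n (c k) = smult [:a k:] (\<Prod>i<n. lin (vec2 (U k i)))"
    by metis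
  obtain r l where r: "strict_mono r" "\<And>i. i < n \<Longrightarrow> l i \<in> sphere (0 :: complex \<times> complex) 1"
    "\<And>i. i < n \<Longrightarrow> (\<lambda>k. U (r k) i) \<longlonglongrightarrow> l i"
    using compact_finite_subseq[of "sphere (0 :: complex \<times> complex) 1" n U] aU(2) by auto
  obtain C c1 where C: "\<And>k. (\<Prod>i<n. lin (vec2 (U (r k) i))) = hform n (C k)"
    "(\<Prod>i<n. lin (vec2 (l i))) = hform n c1" "\<And>j. (\<lambda>k. C k j) \<longlonglongrightarrow> c1 j"
    using prod_lin_tendsto[of n "\<lambda>k. U (r k)" l] r(3) by metis
  have vec_nz: "\<exists>j. vec2 p j \<noteq> 0" if "p \<in> sphere 0 1" for p :: "complex \<times> complex"
    unfolding vec2_nonzero using that by auto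
  have "hform n c1 \<noteq> 0" unfolding C(2)[symmetric] using r(2) vec_nz by (auto simp: lin_eq_0_iff)
  then obtain j where j: "j \<le> n" "c1 j \<noteq> 0" unfolding hform_eq_0_iff by blast
  have cC: "c (r k) i = a (r k) * C k i" if "i \<le> n" for i k
    using aU(3)[of "r k"] that unfolding C(1) smult_hform hform_eq_iff by blast
  have lim': "(\<lambda>k. c (r k) i) \<longlonglongrightarrow> c0 i" if "i \<le> n" for i
    using LIMSEQ_subseq_LIMSEQ[OF lim[OF that] r(1)] by (simp add: o_def)
  \<comment> \<open>The scalars \<open>a (r k)\<close> are eliminated by cross multiplication with the coefficient at \<open>j\<close>, where
    the limit product does not vanish.\<close>
  have "c0 i = (c0 j / c1 j) * c1 i" if "i \<le> n" for i
  proof -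
    have "(\<lambda>k. c (r k) i * C k j) \<longlonglongrightarrow> c0 i * c1 j"
      by (intro tendsto_intros lim' C(3) that)
    moreover have "(\<lambda>k. c (r k) j * C k i) \<longlonglongrightarrow> c0 j * c1 i"
      by (intro tendsto_intros lim' C(3) j)
    moreover have "c (r k) i * C k j = c (r k) j * C k i" for k
      using cC that j by simp
    ultimately have "c0 i * c1 j = c0 j * c1 i" using LIMSEQ_unique by simp
    then show ?thesis using j by (simp add: field_simps)
  qed
  then have c0: "hform n c0 = smult [:c0 j / c1 j:] (\<Prod>i<n. lin (vec2 (l i)))"
    unfolding C(2) smult_hform hform_eq_iff by blast
  then have "c0 j / c1 j \<noteq> 0" using nz(2) by auto
  then have "zero_sum \<psi> (hform n c0) = (\<Sum>i<n. \<psi> (abs_cproj (vec2 (l i))))"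
    unfolding c0 by (intro zero_sum_prod_lin vec_nz r)
  moreover have "zero_sum \<psi> (hform n (c (r k))) = (\<Sum>i<n. \<psi> (abs_cproj (vec2 (U (r k) i))))" for k
    unfolding aU(3) by (intro zero_sum_prod_lin vec_nz aU)
  moreover have "(\<lambda>k. \<Sum>i<n. \<psi> (abs_cproj (vec2 (U (r k) i)))) \<longlonglongrightarrow>
      (\<Sum>i<n. \<psi> (abs_cproj (vec2 (l i))))"
  proof (intro tendsto_sum)
    fix i assume i: "i \<in> {..<n}"
    have "continuous_on (sphere 0 1) (\<lambda>p :: complex \<times> complex. \<psi> (abs_cproj (vec2 p)))"
      by (rule continuous_on_compose2[OF \<psi> continuous_on_abs_vec2]) simp
    then show "(\<lambda>k. \<psi> (abs_cproj (vec2 (U (r k) i)))) \<longlonglongrightarrow> \<psi> (abs_cproj (vec2 (l i)))"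
      by (rule continuous_on_tendsto_compose) (use i r aU in auto)
  qed
  ultimately show ?thesis using that[OF r(1)] by simp
qed

text \<open>
  A sequence of reals converges to \<open>l\<close> if each of its subsequences has a subsequence that converges
  to \<open>l\<close>.
\<close>
theorem continuous_on_zero_sum:
  fixes \<psi> :: "p1 \<Rightarrow> real"
  assumes \<psi>: "continuous_on UNIV \<psi>"
  shows "continuous_on {c. hform n c \<noteq> 0} (\<lambda>c. zero_sum \<psi> (hform n c))"
proof (rule continuous_on_sequentiallyI)
  fix c :: "nat \<Rightarrow> nat \<Rightarrow> complex" and c0
  assume c: "\<forall>k. c k \<in> {c. hform n c \<noteq> 0}" "c0 \<in> {c. hform n c \<noteq> 0}" "c \<longlonglongrightarrow> c0"
  have lim: "(\<lambda>k. c k j) \<longlonglongrightarrow> c0 j" for j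
    using c(3) by (rule continuous_on_tendsto_compose[OF continuous_on_product_coordinates]) auto
  show "(\<lambda>k. zero_sum \<psi> (hform n (c k))) \<longlonglongrightarrow> zero_sum \<psi> (hform n c0)"
  proof (rule ccontr)
    assume "\<not> (\<lambda>k. zero_sum \<psi> (hform n (c k))) \<longlonglongrightarrow> zero_sum \<psi> (hform n c0)"
    then obtain e where e: "e > 0"
      "\<not> (\<forall>\<^sub>F k in sequentially. dist (zero_sum \<psi> (hform n (c k))) (zero_sum \<psi> (hform n c0)) < e)"
      unfolding tendsto_iff by blast
    from not_eventually_sequentiallyD[OF e(2)] obtain r :: "nat \<Rightarrow> nat" where r: "strict_mono r"
      "\<forall>k. \<not> dist (zero_sum \<psi> (hform n (c (r k)))) (zero_sum \<psi> (hform n c0)) < e"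
      by (elim exE conjE)
    have "(\<lambda>k. c (r k) j) \<longlonglongrightarrow> c0 j" for j
      using LIMSEQ_subseq_LIMSEQ[OF lim r(1)] by (simp add: o_def)
    then obtain r' :: "nat \<Rightarrow> nat" where "(\<lambda>k. zero_sum \<psi> (hform n (c (r (r' k))))) \<longlonglongrightarrow> zero_sum \<psi> (hform n c0)"
      using zero_sum_subseq[OF \<psi>, of n "\<lambda>k. c (r k)" c0] c(1,2) by blast
    then have "\<forall>\<^sub>F k in sequentially. dist (zero_sum \<psi> (hform n (c (r (r' k))))) (zero_sum \<psi> (hform n c0)) < e"
      using e(1) by (rule tendstoD)
    then show False using r(2) by simp
  qed
qed

section \<open>The pencil of a pair of forms\<close>

definition pencil :: "nat \<Rightarrow> ratpt \<Rightarrow> (2 \<Rightarrow> complex) \<Rightarrow> complex poly poly" where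
  "pencil d \<Phi> u = smult [:u 1:] (form d \<Phi> 0) - smult [:u 0:] (form d \<Phi> 1)"

definition red_pencil :: "nat \<Rightarrow> ratpt \<Rightarrow> (2 \<Rightarrow> complex) \<Rightarrow> complex poly poly" where
  "red_pencil d \<Phi> u = smult [:u 1:] (red_form d \<Phi> 0) - smult [:u 0:] (red_form d \<Phi> 1)"

text \<open>
  This is the linear independence of the two forms of \<open>\<Phi>\<close>. It says that the reduction is not
  constant, in the form in which the continuity of zeros consumes it.
\<close>
definition nonconst :: "nat \<Rightarrow> ratpt \<Rightarrow> bool" where
  "nonconst d \<Phi> \<longleftrightarrow> (\<forall>u. (\<exists>i. u i \<noteq> 0) \<longrightarrow> pencil d \<Phi> u \<noteq> 0)"

lemma pencil_eq_hform:
  "pencil d \<Phi> u = hform d (\<lambda>j. u 1 * rep_cproj \<Phi> (0, j) - u 0 * rep_cproj \<Phi> (1, j))"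
  by (simp add: pencil_def form_eq_hform smult_hform diff_hform)

lemma pencil_eq_gcd_mult: "pencil d \<Phi> u = gcd_form d \<Phi> * red_pencil d \<Phi> u"
proof -
  have "form d \<Phi> i = gcd_form d \<Phi> * red_form d \<Phi> i" for i
    using exhaust_0_1[of i] by (auto simp: red_form_def gcd_form_def)
  then show ?thesis by (simp add: pencil_def red_pencil_def algebra_simps)
qed

text \<open>
  Linearly dependent coprime forms are constants, because one of them divides the other.
\<close>
lemma dependent_coprime:
  fixes p q :: "complex poly poly"
  assumes "coprime p q" "\<exists>i. u i \<noteq> 0" "smult [:u 1:] p = smult [:u (0::2):] q"
  obtains a b where "p = [:[:a:]:]" "q = [:[:b:]:]" "a \<noteq> 0 \<or> b \<noteq> 0"
proof (cases "u 1 = 0")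
  case False
  then have "p = smult [:1 / u 1:] (smult [:u 1:] p)" by (simp flip: one_pCons)
  then have p: "p = smult [:u 0 / u 1:] q" unfolding assms(3) by simp
  then have "q dvd p" by (metis dvd_refl dvd_smult)
  then have "is_unit q" using assms(1) by (metis coprime_common_divisor dvd_refl)
  then obtain b where "b \<noteq> 0" "q = [:[:b:]:]" by (rule is_unit_poly_polyE)
  then show ?thesis using p that by auto
next
  case True
  then have u: "u 0 \<noteq> 0" using assms(2) unfolding ex_2 by auto
  then have "q = smult [:1 / u 0:] (smult [:u 0:] q)" by (simp flip: one_pCons)
  then have "q = 0" unfolding assms(3)[symmetric] True by simp
  then have "is_unit p" using assms(1) by simp
  then obtain a where "a \<noteq> 0" "p = [:[:a:]:]" by (rule is_unit_poly_polyE)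
  then show ?thesis using \<open>q = 0\<close> that[of a 0] by auto
qed

lemma nonconst_Rat:
  assumes "\<Phi> \<in> Rat d" "d \<ge> 1" shows "nonconst d \<Phi>"
  unfolding nonconst_def
proof (intro allI impI notI)
  fix u :: "2 \<Rightarrow> complex" assume u: "\<exists>i. u i \<noteq> 0" "pencil d \<Phi> u = 0"
  have cop: "coprime (form d \<Phi> 0) (form d \<Phi> 1)" using assms by (simp add: Rat_def)
  have "smult [:u 1:] (form d \<Phi> 0) = smult [:u 0:] (form d \<Phi> 1)"
    using u(2) by (simp add: pencil_def)
  then obtain a b where "form d \<Phi> 0 = [:[:a:]:]" "form d \<Phi> 1 = [:[:b:]:]" "a \<noteq> 0 \<or> b \<noteq> 0"
    by (rule dependent_coprime[OF cop u(1)])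
  then obtain c i where c: "form d \<Phi> i = [:[:c:]:]" "c \<noteq> 0" by blast
  then have "hform d (\<lambda>j. rep_cproj \<Phi> (i, j)) \<noteq> 0" by (simp flip: form_eq_hform)
  then obtain M where M: "size M = d" "splits (form d \<Phi> i) M"
    unfolding form_eq_hform by (rule hform_splits)
  have "splits (form d \<Phi> i) {#}" unfolding c(1) by (rule splits_unit[OF is_unit_scalar[OF c(2)]])
  then have "M = {#}" using zeros_splits M(2) by metis
  then show False using M(1) assms(2) by simp
qed

text \<open>
  If a member of the pencil vanishes, so does the corresponding member of the reduced pencil. The
  reduced forms are then constants, and the reduction is a constant map.
\<close>
lemma nonconst_reduction:
  assumes "\<Phi> \<in> Rat_bar d" "\<not> reduction d \<Phi> constant_on UNIV" shows "nonconst d \<Phi>"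
  unfolding nonconst_def
proof (intro allI impI notI)
  fix u :: "2 \<Rightarrow> complex" assume u: "\<exists>i. u i \<noteq> 0" "pencil d \<Phi> u = 0"
  obtain i j where ij: "rep_cproj \<Phi> (i, j) \<noteq> 0" using rep_cproj_nonzero[of \<Phi>] by auto
  then have "j \<le> d" using assms(1) unfolding Rat_bar_def by (auto simp: not_less[symmetric])
  then have "form d \<Phi> i \<noteq> 0" using ij unfolding form_eq_hform hform_eq_0_iff by blast
  then have nz: "form d \<Phi> 0 \<noteq> 0 \<or> form d \<Phi> 1 \<noteq> 0" using exhaust_0_1[of i] by auto
  then have cop: "coprime (red_form d \<Phi> 0) (red_form d \<Phi> 1)"
    unfolding red_form_def gcd_form_def by (rule div_gcd_coprime)
  have "gcd_form d \<Phi> \<noteq> 0" using nz by (simp add: gcd_form_def)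
  then have "red_pencil d \<Phi> u = 0" using u(2) by (simp add: pencil_eq_gcd_mult)
  then have "smult [:u 1:] (red_form d \<Phi> 0) = smult [:u 0:] (red_form d \<Phi> 1)"
    by (simp add: red_pencil_def)
  then obtain a b where "red_form d \<Phi> 0 = [:[:a:]:]" "red_form d \<Phi> 1 = [:[:b:]:]"
    by (rule dependent_coprime[OF cop u(1)])
  then have ab: "\<exists>a. red_form d \<Phi> i = [:[:a:]:]" for i using exhaust_0_1[of i] by auto
  have "eval2 (red_form d \<Phi> i) x = eval2 (red_form d \<Phi> i) y" for i x y
    using ab[of i] by (auto simp: eval2_def)
  then have "(\<lambda>i. eval2 (red_form d \<Phi> i) x) = (\<lambda>i. eval2 (red_form d \<Phi> i) y)" for x y
    by blast
  then have "reduction d \<Phi> x = reduction d \<Phi> y" for x y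
    unfolding reduction_def by (rule arg_cong)
  then have "reduction d \<Phi> constant_on UNIV"
    unfolding constant_on_def by blast
  then show False using assms(2) by simp
qed

lemma gcd_form_nonzero: "nonconst d \<Phi> \<Longrightarrow> gcd_form d \<Phi> \<noteq> 0"
  using rep_cproj_nonzero[of "undefined :: p1"] by (auto simp: nonconst_def pencil_eq_gcd_mult)

lemma
  assumes "nonconst d \<Phi>" "\<exists>i. u i \<noteq> 0"
  shows size_zeros_pencil: "size (zeros (pencil d \<Phi> u)) = d"
    and splits_gcd_form: "splits (gcd_form d \<Phi>) (zeros (gcd_form d \<Phi>))"
    and splits_red_pencil: "splits (red_pencil d \<Phi> u) (zeros (red_pencil d \<Phi> u))"
    and zeros_pencil: "zeros (pencil d \<Phi> u) = zeros (gcd_form d \<Phi>) + zeros (red_pencil d \<Phi> u)"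
proof -
  have "pencil d \<Phi> u \<noteq> 0" using assms by (simp add: nonconst_def)
  then obtain M where M: "size M = d" "splits (pencil d \<Phi> u) M"
    unfolding pencil_eq_hform by (rule hform_splits)
  show "size (zeros (pencil d \<Phi> u)) = d" using M zeros_splits by metis
  obtain N where N: "splits (gcd_form d \<Phi>) N"
    by (rule splits_dvd[OF M(2), of "gcd_form d \<Phi>"]) (simp add: pencil_eq_gcd_mult)
  then show 1: "splits (gcd_form d \<Phi>) (zeros (gcd_form d \<Phi>))" using zeros_splits by metis
  obtain N' where "splits (red_pencil d \<Phi> u) N'"
    by (rule splits_dvd[OF M(2), of "red_pencil d \<Phi> u"]) (simp add: pencil_eq_gcd_mult)
  then show 2: "splits (red_pencil d \<Phi> u) (zeros (red_pencil d \<Phi> u))" using zeros_splits by metis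
  show "zeros (pencil d \<Phi> u) = zeros (gcd_form d \<Phi>) + zeros (red_pencil d \<Phi> u)"
    unfolding pencil_eq_gcd_mult by (rule zeros_splits[OF splits_mult[OF 1 2]])
qed

lemma hole_mult_eq_count: "nonconst d \<Phi> \<Longrightarrow> hole_mult d \<Phi> x = count (zeros (gcd_form d \<Phi>)) x"
  unfolding hole_mult_def
  by (rule ord_at_splits, rule splits_gcd_form[OF _ rep_cproj_nonzero[of x]])

lemma fibre_mult_eq_count:
  "nonconst d \<Phi> \<Longrightarrow> fibre_mult d \<Phi> y x = count (zeros (red_pencil d \<Phi> (rep_cproj y))) x"
  unfolding fibre_mult_def red_pencil_def[symmetric]
  by (rule ord_at_splits, rule splits_red_pencil[OF _ rep_cproj_nonzero[of y]])

text \<open>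
  The member of the reduced pencil at \<open>y\<close> vanishes at \<open>x\<close> iff the vector of values at \<open>x\<close> of the two
  reduced forms is proportional to \<open>y\<close>. This vector is nonzero as the reduced forms are coprime.
\<close>
lemma reduction_eq_iff:
  assumes "nonconst d \<Phi>"
  shows "reduction d \<Phi> x = y \<longleftrightarrow> x \<in># zeros (red_pencil d \<Phi> (rep_cproj y))"
proof -
  have const: "[:1 :: complex:] = 1" "[:- 1 :: complex:] = - 1" by (simp_all add: one_pCons)
  \<comment> \<open>The reduced forms are themselves members of the reduced pencil, and hence split.\<close>
  have "red_pencil d \<Phi> (vec2 (0, 1)) = red_form d \<Phi> 0" "red_pencil d \<Phi> (vec2 (-1, 0)) = red_form d \<Phi> 1"
    by (simp_all add: red_pencil_def const)
  moreover have "\<exists>i. vec2 (0, 1::complex) i \<noteq> 0" "\<exists>i. vec2 (-1::complex, 0) i \<noteq> 0"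
    unfolding ex_2 by auto
  ultimately have s: "splits (red_form d \<Phi> i) (zeros (red_form d \<Phi> i))" for i
    using splits_red_pencil[OF assms] exhaust_0_1[of i] by metis
  have "form d \<Phi> 0 \<noteq> 0 \<or> form d \<Phi> 1 \<noteq> 0" using gcd_form_nonzero[OF assms] by (auto simp: gcd_form_def)
  then have cop: "coprime (red_form d \<Phi> 0) (red_form d \<Phi> 1)"
    unfolding red_form_def gcd_form_def by (rule div_gcd_coprime)
  have nz: "\<exists>i. eval2 (red_form d \<Phi> i) x \<noteq> 0"
  proof (rule ccontr)
    assume "\<not> (\<exists>i. eval2 (red_form d \<Phi> i) x \<noteq> 0)"
    then have "x \<in># zeros (red_form d \<Phi> i)" for i using splits_eval2_eq_0[OF s[of i]] by blast
    then have pos: "ord_at x (red_form d \<Phi> i) \<noteq> 0" for i using ord_at_splits[OF s[of i]] by simp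
    have "lin_form x dvd red_form d \<Phi> i" for i
    proof (rule ccontr)
      assume "\<not> lin_form x dvd red_form d \<Phi> i"
      then show False using pos[of i] by (simp add: ord_at_def not_dvd_imp_multiplicity_0)
    qed
    then have "is_unit (lin_form x)" by (intro coprime_common_divisor[OF cop])
    then show False using prime_elem_not_unit[OF prime_elem_lin_form] by simp
  qed
  have "reduction d \<Phi> x = y \<longleftrightarrow> abs_cproj (\<lambda>i. eval2 (red_form d \<Phi> i) x) = abs_cproj (rep_cproj y)"
    by (simp add: reduction_def)
  also have "\<dots> \<longleftrightarrow> eval2 (red_pencil d \<Phi> (rep_cproj y)) x = 0"
    unfolding abs_cproj_eq_cross[OF nz rep_cproj_nonzero]
    by (simp add: red_pencil_def eval2_diff eval2_smult mult.commute)
  also have "\<dots> \<longleftrightarrow> x \<in># zeros (red_pencil d \<Phi> (rep_cproj y))"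
    by (rule splits_eval2_eq_0[OF splits_red_pencil[OF assms rep_cproj_nonzero]])
  finally show ?thesis .
qed

lemma sum_mset_eq_sum_count:
  fixes f :: "'b \<Rightarrow> 'a::comm_semiring_1"
  assumes "finite A" "set_mset M \<subseteq> A"
  shows "(\<Sum>x\<in>#M. f x) = (\<Sum>x\<in>A. of_nat (count M x) * f x)"
  using assms(2)
proof (induction M)
  case (add a M)
  have "(\<Sum>x\<in>A. of_nat (count (add_mset a M) x) * f x) =
      (\<Sum>x\<in>A. of_nat (count M x) * f x + (if x = a then f x else 0))"
    by (intro sum.cong) (auto simp: algebra_simps)
  also have "\<dots> = (\<Sum>x\<in>A. of_nat (count M x) * f x) + f a"
    using assms(1) add.prems by (simp add: sum.distrib)
  finally show ?case using add by (simp add: add.commute)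
qed simp

lemma fun_push_eq_zero_sum:
  assumes "nonconst d \<Phi>"
  shows "fun_push d \<Phi> \<psi> y = zero_sum \<psi> (red_pencil d \<Phi> (rep_cproj y))"
proof -
  have "{x. reduction d \<Phi> x = y} = set_mset (zeros (red_pencil d \<Phi> (rep_cproj y)))"
    using reduction_eq_iff[OF assms] by auto
  then show ?thesis
    unfolding fun_push_def zero_sum_def fibre_mult_eq_count[OF assms]
    by (subst sum_mset_eq_sum_count[OF _ order_refl]) simp_all
qed

lemma zero_sum_hole_mult:
  fixes f :: "p1 \<Rightarrow> 'a::comm_semiring_1"
  assumes "nonconst d \<Phi>"
  shows "(\<Sum>x | hole_mult d \<Phi> x \<noteq> 0. of_nat (hole_mult d \<Phi> x) * f x) = zero_sum f (gcd_form d \<Phi>)"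
proof -
  have "{x. hole_mult d \<Phi> x \<noteq> 0} = set_mset (zeros (gcd_form d \<Phi>))"
    by (auto simp: hole_mult_eq_count[OF assms])
  then show ?thesis unfolding zero_sum_def hole_mult_eq_count[OF assms]
    by (subst sum_mset_eq_sum_count[OF _ order_refl]) simp_all
qed

lemma zero_sum_pencil:
  assumes "nonconst d \<Phi>" "\<exists>i. u i \<noteq> 0"
  shows "zero_sum f (pencil d \<Phi> u) = zero_sum f (gcd_form d \<Phi>) + zero_sum f (red_pencil d \<Phi> u)"
  by (simp add: zero_sum_def zeros_pencil[OF assms])

lemma red_pencil_Rat: "\<Phi> \<in> Rat d \<Longrightarrow> red_pencil d \<Phi> = pencil d \<Phi>"
  by (simp add: fun_eq_iff Rat_def red_pencil_def pencil_def red_form_def gcd_form_def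
        coprime_iff_gcd_eq_1)

lemma zeros_scale: "a \<noteq> 0 \<Longrightarrow> zeros (smult [:a:] G) = zeros G"
  by (simp add: zeros_def ord_at_scale)

text \<open>
  Near each point, \<open>h\<close> and \<open>w\<close> can be replaced by their coordinates in suitable charts; this changes
  the member of the pencil by a scalar only, and makes its coefficients continuous.
\<close>
theorem continuous_on_zero_sum_pencil:
  fixes \<psi> :: "p1 \<Rightarrow> real" and h :: "'a::topological_space \<Rightarrow> ratpt" and w :: "'a \<Rightarrow> p1"
  assumes \<psi>: "continuous_on UNIV \<psi>" and h: "continuous_on S h" and w: "continuous_on S w"
    and nc: "\<And>s. s \<in> S \<Longrightarrow> nonconst d (h s)"
  shows "continuous_on S (\<lambda>s. zero_sum \<psi> (pencil d (h s) (rep_cproj (w s))))"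
  unfolding continuous_on_def
proof
  fix s0 assume s0: "s0 \<in> S"
  obtain i0 where i0: "rep_cproj (h s0) i0 \<noteq> 0" using rep_cproj_nonzero[of "h s0"] by blast
  obtain j0 where j0: "rep_cproj (w s0) j0 \<noteq> 0" using rep_cproj_nonzero[of "w s0"] by blast
  let ?F = "at s0 within S"
  have h': "(h \<longlongrightarrow> h s0) ?F" and w': "(w \<longlongrightarrow> w s0) ?F"
    using h w s0 by (auto simp: continuous_on_def)
  note ch = tendsto_chart[OF h' i0] and cw = tendsto_chart[OF w' j0]
  define c where "c s = (\<lambda>j. chart j0 (w s) 1 * chart i0 (h s) (0, j) - chart j0 (w s) 0 * chart i0 (h s) (1, j))" for s
  have eq: "hform d (c s) \<noteq> 0"
    "zero_sum \<psi> (pencil d (h s) (rep_cproj (w s))) = zero_sum \<psi> (hform d (c s))"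
    if "rep_cproj (h s) i0 \<noteq> 0" "rep_cproj (w s) j0 \<noteq> 0" "s \<in> S" for s
  proof -
    define a where "a = 1 / (rep_cproj (w s) j0 * rep_cproj (h s) i0)"
    have "a \<noteq> 0" using that by (simp add: a_def)
    have nz: "pencil d (h s) (rep_cproj (w s)) \<noteq> 0"
      using nc[OF that(3)] rep_cproj_nonzero[of "w s"] by (simp add: nonconst_def)
    have "hform d (c s) = smult [:a:] (pencil d (h s) (rep_cproj (w s)))"
      unfolding pencil_eq_hform smult_hform hform_eq_iff using that
      by (auto simp: a_def c_def chart_def field_simps)
    then show "hform d (c s) \<noteq> 0"
      "zero_sum \<psi> (pencil d (h s) (rep_cproj (w s))) = zero_sum \<psi> (hform d (c s))"
      using nz \<open>a \<noteq> 0\<close> by (simp_all add: zero_sum_def zeros_scale)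
  qed
  have evS: "\<forall>\<^sub>F s in ?F. s \<in> S" by (simp add: eventually_at_filter)
  have "(c \<longlongrightarrow> c s0) ?F"
    using ch(1) cw(1) unfolding tendsto_fun_iff c_def by (intro allI tendsto_intros) blast+
  then have "((\<lambda>s. zero_sum \<psi> (hform d (c s))) \<longlongrightarrow> zero_sum \<psi> (hform d (c s0))) ?F"
  proof (rule continuous_on_tendsto_compose[OF continuous_on_zero_sum[OF \<psi>]])
    show "\<forall>\<^sub>F s in ?F. c s \<in> {c. hform d c \<noteq> 0}"
      using ch(2) cw(2) evS by eventually_elim (use eq(1) in simp)
  qed (use eq(1) i0 j0 s0 in simp)
  moreover have "\<forall>\<^sub>F s in ?F. zero_sum \<psi> (hform d (c s)) = zero_sum \<psi> (pencil d (h s) (rep_cproj (w s)))"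
    using ch(2) cw(2) evS by eventually_elim (use eq(2) in simp)
  ultimately show "((\<lambda>s. zero_sum \<psi> (pencil d (h s) (rep_cproj (w s)))) \<longlongrightarrow>
      zero_sum \<psi> (pencil d (h s0) (rep_cproj (w s0)))) ?F"
    unfolding eq(2)[OF i0 j0 s0] by (rule Lim_transform_eventually)
qed

section \<open>Postcomposition with Moebius transformations\<close>

definition moebius_vec :: "(2 \<times> nat \<Rightarrow> complex) \<Rightarrow> (2 \<times> nat \<Rightarrow> complex) \<Rightarrow> 2 \<times> nat \<Rightarrow> complex" where
  "moebius_vec a \<phi> = (\<lambda>(i, j). a (i, 1) * \<phi> (0, j) + a (i, 0) * \<phi> (1, j))"

lemma moebius_comp_eq: "moebius_comp A \<Phi> = abs_cproj (moebius_vec (rep_cproj A) (rep_cproj \<Phi>))"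
  by (simp add: moebius_comp_def moebius_vec_def)

text \<open>
  If the determinant vanishes, either column of the coefficient matrix is the index \<open>u\<close> of a vanishing
  member of the pencil of \<open>A\<close>, so that both columns are zero.
\<close>
lemma det_nonzero:
  assumes "A \<in> Rat 1"
  shows "rep_cproj A (1, 0) * rep_cproj A (0, 1) - rep_cproj A (0, 0) * rep_cproj A (1, 1) \<noteq> 0"
proof
  assume det: "rep_cproj A (1, 0) * rep_cproj A (0, 1) - rep_cproj A (0, 0) * rep_cproj A (1, 1) = 0"
  have nc: "u 0 = 0 \<and> u 1 = 0"
    if "u 1 * rep_cproj A (0, 0) = u 0 * rep_cproj A (1, 0)"
      "u 1 * rep_cproj A (0, 1) = u 0 * rep_cproj A (1, 1)" for u :: "2 \<Rightarrow> complex"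
  proof -
    have "pencil 1 A u = 0"
      unfolding pencil_eq_hform hform_eq_0_iff using that by (auto simp: le_Suc_eq)
    then have "\<not> (\<exists>i. u i \<noteq> 0)" using nonconst_Rat[OF assms] unfolding nonconst_def by auto
    then show ?thesis by blast
  qed
  have 1: "rep_cproj A (0, 1) = 0 \<and> rep_cproj A (1, 1) = 0"
    using nc[of "\<lambda>i. rep_cproj A (i, 1)"] det by (simp add: algebra_simps)
  then have "rep_cproj A (0, 0) = 0 \<and> rep_cproj A (1, 0) = 0"
    using nc[of "\<lambda>i. rep_cproj A (i, 0)"] by simp
  then show False using nc[of "\<lambda>_. 1"] 1 by simp
qed

lemma moebius_vec_nonzero:
  assumes "A \<in> Rat 1" shows "\<exists>k. moebius_vec (rep_cproj A) (rep_cproj \<Phi>) k \<noteq> 0"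
proof (rule ccontr)
  assume "\<not> (\<exists>k. moebius_vec (rep_cproj A) (rep_cproj \<Phi>) k \<noteq> 0)"
  then have z: "moebius_vec (rep_cproj A) (rep_cproj \<Phi>) (i, j) = 0" for i j by blast
  let ?D = "rep_cproj A (1, 0) * rep_cproj A (0, 1) - rep_cproj A (0, 0) * rep_cproj A (1, 1)"
  have "?D * rep_cproj \<Phi> (0, j) = 0" "?D * rep_cproj \<Phi> (1, j) = 0" for j
    using z[of 0 j] z[of 1 j] unfolding moebius_vec_def by (simp_all, algebra+)
  then have "rep_cproj \<Phi> (0, j) = 0" "rep_cproj \<Phi> (1, j) = 0" for j using det_nonzero[OF assms] by auto
  then have "rep_cproj \<Phi> (i, j) = 0" for i j using exhaust_0_1[of i] by auto
  then show False using rep_cproj_nonzero[of \<Phi>] by auto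
qed

text \<open>
  The bilinear map \<open>moebius_vec\<close> is continuous in the coordinates given by charts, and by invertibility
  of the limit it does not vanish there.
\<close>
lemma tendsto_moebius_comp:
  assumes A: "(A \<longlongrightarrow> A0) F" and f: "(f \<longlongrightarrow> f0) F" and "A0 \<in> Rat 1"
  shows "((\<lambda>s. moebius_comp (A s) (f s)) \<longlongrightarrow> moebius_comp A0 f0) F"
proof -
  obtain i where i: "rep_cproj A0 i \<noteq> 0" using rep_cproj_nonzero[of A0] by blast
  obtain k where k: "rep_cproj f0 k \<noteq> 0" using rep_cproj_nonzero[of f0] by blast
  define v where "v B \<Phi> = moebius_vec (chart i B) (chart k \<Phi>)" for B \<Phi>
  have scale: "moebius_vec (rep_cproj B) (rep_cproj \<Phi>) = (\<lambda>m. (rep_cproj B i * rep_cproj \<Phi> k) * v B \<Phi> m)"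
    if "rep_cproj B i \<noteq> 0" "rep_cproj \<Phi> k \<noteq> 0" for B \<Phi>
    using that by (auto simp: v_def moebius_vec_def chart_def fun_eq_iff field_simps)
  then have eq: "moebius_comp B \<Phi> = abs_cproj (v B \<Phi>)"
    if "rep_cproj B i \<noteq> 0" "rep_cproj \<Phi> k \<noteq> 0" "\<exists>m. v B \<Phi> m \<noteq> 0" for B \<Phi>
    unfolding moebius_comp_eq scale[OF that(1,2)] using that by (intro abs_cproj_scale) auto
  have nz: "\<exists>m. v A0 f0 m \<noteq> 0"
    using moebius_vec_nonzero[OF assms(3), of f0] unfolding scale[OF i k] by auto
  have "((\<lambda>s. v (A s) (f s)) \<longlongrightarrow> v A0 f0) F"
    using tendsto_chart(1)[OF A i] tendsto_chart(1)[OF f k]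
    unfolding tendsto_fun_iff v_def moebius_vec_def
    by (auto intro!: tendsto_intros simp: split_beta)
  note lim = tendsto_abs_cproj[OF this nz]
  have "\<forall>\<^sub>F s in F. abs_cproj (v (A s) (f s)) = moebius_comp (A s) (f s)"
    using lim(2) tendsto_chart(2)[OF A i] tendsto_chart(2)[OF f k]
    by eventually_elim (simp add: eq)
  with lim(1) show ?thesis unfolding eq[OF i k nz] by (rule Lim_transform_eventually)
qed

lemma pencil_scale: "pencil d \<Phi> (\<lambda>i. c * u i) = smult [:c:] (pencil d \<Phi> u)"
  unfolding pencil_eq_hform smult_hform by (simp add: algebra_simps)

text \<open>
  The adjugate matrix of \<open>A\<close> applied to \<open>u\<close>: the transformation of the indices of the pencil that is
  induced by postcomposition with \<open>A\<close>.
\<close>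
definition moebius_dual :: "ratpt \<Rightarrow> (2 \<Rightarrow> complex) \<Rightarrow> 2 \<Rightarrow> complex" where
  "moebius_dual A u = vec2 (u 0 * rep_cproj A (1, 0) - u 1 * rep_cproj A (0, 0),
                            u 1 * rep_cproj A (0, 1) - u 0 * rep_cproj A (1, 1))"

lemma pencil_moebius_comp:
  assumes "A \<in> Rat 1"
  obtains c where "c \<noteq> 0"
    "\<And>u. pencil d (moebius_comp A \<Phi>) u = smult [:c:] (pencil d \<Phi> (moebius_dual A u))"
proof -
  obtain c where c: "c \<noteq> 0"
    "rep_cproj (moebius_comp A \<Phi>) = (\<lambda>k. c * moebius_vec (rep_cproj A) (rep_cproj \<Phi>) k)"
    unfolding moebius_comp_eq by (rule rep_abs_cproj[OF moebius_vec_nonzero[OF assms]])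
  have "pencil d (moebius_comp A \<Phi>) u = smult [:c:] (pencil d \<Phi> (moebius_dual A u))" for u
    unfolding pencil_eq_hform smult_hform c(2) by (simp add: moebius_vec_def moebius_dual_def algebra_simps)
  then show ?thesis using that c(1) by blast
qed

lemma moebius_dual_nonzero:
  assumes "A \<in> Rat 1" "\<exists>i. u i \<noteq> 0" shows "\<exists>i. moebius_dual A u i \<noteq> 0"
proof (rule ccontr)
  assume "\<not> (\<exists>i. moebius_dual A u i \<noteq> 0)"
  then have z: "moebius_dual A u 0 = 0" "moebius_dual A u 1 = 0" by blast+
  let ?D = "rep_cproj A (1, 0) * rep_cproj A (0, 1) - rep_cproj A (0, 0) * rep_cproj A (1, 1)"
  have "?D * u 0 = 0" "?D * u 1 = 0"
    using z unfolding moebius_dual_def vec2_simps fst_conv snd_conv by algebra+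
  then show False using det_nonzero[OF assms(1)] assms(2) unfolding ex_2 by auto
qed

lemma nonconst_moebius_comp:
  assumes "A \<in> Rat 1" "nonconst d \<Phi>" shows "nonconst d (moebius_comp A \<Phi>)"
proof -
  obtain c where "c \<noteq> 0"
    "\<And>u. pencil d (moebius_comp A \<Phi>) u = smult [:c:] (pencil d \<Phi> (moebius_dual A u))"
    by (rule pencil_moebius_comp[OF assms(1), of d \<Phi>]) blast
  then show ?thesis
    using assms(2) moebius_dual_nonzero[OF assms(1)] by (simp add: nonconst_def)
qed

lemma eval2_form_1: "eval2 (form 1 A i) z = rep_cproj A (i, 1) * rep_cproj z 0 + rep_cproj A (i, 0) * rep_cproj z 1"
proof -
  have "form 1 A i = [: [:0, rep_cproj A (i, 1):], [: rep_cproj A (i, 0):] :]"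
    by (simp add: form_def monom_0 monom_Suc)
  then show ?thesis by (simp add: eval2_def)
qed

text \<open>
  The adjugate undoes \<open>A\<close> up to the determinant, so the preimages of \<open>A(z)\<close> under \<open>A \<circ> \<Phi>\<close> are those of
  \<open>z\<close> under \<open>\<Phi>\<close>. Holes are the same for both.
\<close>
lemma zeros_pencil_moebius_comp:
  assumes "A \<in> Rat 1"
  shows "zeros (pencil d (moebius_comp A \<Phi>) (rep_cproj (reduction 1 A z))) = zeros (pencil d \<Phi> (rep_cproj z))"
proof -
  let ?a = "rep_cproj A"
  let ?D = "?a (1, 0) * ?a (0, 1) - ?a (0, 0) * ?a (1, 1)"
  define v where "v = (\<lambda>i. ?a (i, 1) * rep_cproj z 0 + ?a (i, 0) * rep_cproj z 1)"
  have D: "?D \<noteq> 0" by (rule det_nonzero[OF assms])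
  have "red_form 1 A i = form 1 A i" for i
    using assms by (simp add: Rat_def red_form_def gcd_form_def coprime_iff_gcd_eq_1)
  then have red: "reduction 1 A z = abs_cproj v"
    unfolding reduction_def v_def eval2_form_1[symmetric] by simp
  have dual: "moebius_dual A (\<lambda>i. e * v i) = (\<lambda>i. (e * ?D) * rep_cproj z i)" for e
  proof
    fix i show "moebius_dual A (\<lambda>i. e * v i) i = (e * ?D) * rep_cproj z i"
      using exhaust_0_1[of i] by (auto simp: moebius_dual_def v_def algebra_simps)
  qed
  have "\<exists>i. v i \<noteq> 0"
  proof (rule ccontr)
    assume "\<not> (\<exists>i. v i \<noteq> 0)"
    then have "v i = 0" for i by blast
    then have "moebius_dual A (\<lambda>i. 1 * v i) = (\<lambda>_. 0)"
      by (auto simp: moebius_dual_def vec2_def fun_eq_iff)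
    then have "rep_cproj z i = 0" for i using D unfolding dual fun_eq_iff by simp
    then show False using rep_cproj_nonzero[of z] by blast
  qed
  then obtain e where e: "e \<noteq> 0" "rep_cproj (abs_cproj v) = (\<lambda>i. e * v i)" by (rule rep_abs_cproj)
  obtain c where c: "c \<noteq> 0"
    "\<And>u. pencil d (moebius_comp A \<Phi>) u = smult [:c:] (pencil d \<Phi> (moebius_dual A u))"
    by (rule pencil_moebius_comp[OF assms, of d \<Phi>]) blast
  have "e * ?D \<noteq> 0" using e(1) D by simp
  then show ?thesis
    unfolding red e(2) c(2) dual zeros_scale[OF c(1)] unfolding pencil_scale by (rule zeros_scale)
qed

section \<open>Measures defined by finite kernels\<close>

lemma tendsto_sum_mset:
  fixes f :: "'a \<Rightarrow> nat \<Rightarrow> real"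
  assumes "\<And>x. (\<lambda>n. f x n) \<longlonglongrightarrow> l x"
  shows "(\<lambda>n. \<Sum>x\<in>#M. f x n) \<longlonglongrightarrow> (\<Sum>x\<in>#M. l x)"
  by (induction M) (auto intro!: tendsto_intros assms)

lemma ennreal_sum_mset:
  assumes "\<And>x. 0 \<le> f x"
  shows "ennreal (\<Sum>x\<in>#M. f x) = (\<Sum>x\<in>#M. ennreal (f x))"
proof (induction M)
  case (add x M)
  have "0 \<le> (\<Sum>x\<in>#M. f x)" using assms by (induction M) auto
  then show ?case using add assms by (simp add: ennreal_plus)
qed simp

lemma ennreal_indicator_sum_mset:
  "ennreal (\<Sum>x\<in>#M. indicat_real B x) = (\<Sum>x\<in>#M. indicator B x)"
  by (subst ennreal_sum_mset) (auto simp: ennreal_indicator)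

text \<open>
  Measurability of a map from points to finite multisets of points, tested against continuous
  functions. The maps that occur below assign to \<open>y\<close> the zeros of a member of a pencil.
\<close>
definition mset_kernel :: "(p1 \<Rightarrow> p1 multiset) \<Rightarrow> bool" where
  "mset_kernel K \<longleftrightarrow> (\<forall>\<psi> :: p1 \<Rightarrow> real. continuous_on UNIV \<psi> \<longrightarrow>
     (\<lambda>y. \<Sum>x\<in>#K y. \<psi> x) \<in> borel_measurable borel)"

text \<open>
  The integral over \<open>\<nu>\<close> of the counting measures of the multisets \<open>K y\<close>.
\<close>
definition kernel_measure :: "(p1 \<Rightarrow> p1 multiset) \<Rightarrow> p1 measure \<Rightarrow> p1 measure" where
  "kernel_measure K \<nu> = measure_of UNIV (sets borel) (\<lambda>B. \<integral>\<^sup>+ y. (\<Sum>x\<in>#K y. indicator B x) \<partial>\<nu>)"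

lemma sets_kernel_measure [simp]: "sets (kernel_measure K \<nu>) = sets borel"
  and space_kernel_measure [simp]: "space (kernel_measure K \<nu>) = UNIV"
  using sets.space_closed[of borel] sets.sigma_sets_eq[of borel]
  by (simp_all add: kernel_measure_def)

text \<open>
  By Dynkin's theorem it suffices to consider closed sets, whose indicator functions are limits of
  continuous functions.
\<close>
lemma measurable_kernel_indicator:
  assumes K: "mset_kernel K" and B: "B \<in> sets borel"
  shows "(\<lambda>y. \<Sum>x\<in>#K y. indicat_real B x) \<in> borel_measurable borel"
proof -
  have "Int_stable (Collect closed :: p1 set set)" by (auto simp: Int_stable_def)
  moreover have "Collect closed \<subseteq> Pow (UNIV :: p1 set)" by simp
  moreover have "B \<in> sigma_sets UNIV (Collect closed)" using B unfolding borel_eq_closed by simp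
  ultimately show ?thesis
  proof (induction rule: sigma_sets_induct_disjoint)
    case (basic C)
    then have "closed C" by simp
    then obtain \<psi> :: "nat \<Rightarrow> p1 \<Rightarrow> real" where \<psi>: "\<And>n. continuous_on UNIV (\<psi> n)"
      "\<And>x. (\<lambda>n. \<psi> n x) \<longlonglongrightarrow> indicat_real C x"
      by (rule closed_p1_approx) blast
    show ?case
    proof (rule borel_measurable_LIMSEQ_real)
      show "(\<lambda>n. \<Sum>x\<in>#K y. \<psi> n x) \<longlonglongrightarrow> (\<Sum>x\<in>#K y. indicat_real C x)" for y
        by (rule tendsto_sum_mset[OF \<psi>(2)])
      show "(\<lambda>y. \<Sum>x\<in>#K y. \<psi> n x) \<in> borel_measurable borel" for n
        using K \<psi>(1) by (simp add: mset_kernel_def)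
    qed
  next
    case empty
    then show ?case by simp
  next
    case (compl A)
    have "(\<Sum>x\<in>#M. indicat_real (UNIV - A) x) = (\<Sum>x\<in>#M. 1) - (\<Sum>x\<in>#M. indicat_real A x)" for M
      by (induction M) (auto simp: indicator_def)
    moreover have "(\<lambda>y. \<Sum>x\<in>#K y. (1::real)) \<in> borel_measurable borel"
      using K unfolding mset_kernel_def by (rule allE[of _ "\<lambda>_. 1"]) simp
    ultimately show ?case using compl by simp
  next
    case (union A)
    have "(\<lambda>n. \<Sum>i<n. indicat_real (A i) x) \<longlonglongrightarrow> indicat_real (\<Union>i. A i) x" for x
      using indicator_sums[of A x] union(1) by (auto simp: sums_def disjoint_family_on_def)
    then have "(\<lambda>n. \<Sum>x\<in>#K y. \<Sum>i<n. indicat_real (A i) x) \<longlonglongrightarrow>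
        (\<Sum>x\<in>#K y. indicat_real (\<Union>i. A i) x)" for y
      by (rule tendsto_sum_mset)
    moreover have "(\<Sum>x\<in>#M. \<Sum>i<n. indicat_real (A i) x) = (\<Sum>i<n. \<Sum>x\<in>#M. indicat_real (A i) x)"
      for M and n :: nat
      by (induction M) (auto simp: sum.distrib)
    ultimately have lim: "(\<lambda>n. \<Sum>i<n. \<Sum>x\<in>#K y. indicat_real (A i) x) \<longlonglongrightarrow>
        (\<Sum>x\<in>#K y. indicat_real (\<Union>i. A i) x)" for y
      by simp
    show ?case
    proof (rule borel_measurable_LIMSEQ_real[OF lim])
      show "(\<lambda>y. \<Sum>i<n. \<Sum>x\<in>#K y. indicat_real (A i) x) \<in> borel_measurable borel" for n
        by (intro borel_measurable_sum union(3))
    qed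
  qed
qed

lemma measurable_kernel_indicator_ennreal:
  assumes "mset_kernel K" "B \<in> sets borel" "sets \<nu> = sets borel"
  shows "(\<lambda>y. \<Sum>x\<in>#K y. indicator B x :: ennreal) \<in> borel_measurable \<nu>"
proof -
  have "(\<lambda>y. ennreal (\<Sum>x\<in>#K y. indicat_real B x)) \<in> borel_measurable borel"
    using measurable_kernel_indicator[OF assms(1,2)] by simp
  then show ?thesis
    unfolding ennreal_indicator_sum_mset by (simp cong: measurable_cong_sets add: assms(3))
qed

lemma suminf_sum_mset_ennreal:
  fixes f :: "nat \<Rightarrow> 'a \<Rightarrow> ennreal"
  shows "(\<Sum>i. \<Sum>x\<in>#M. f i x) = (\<Sum>x\<in>#M. \<Sum>i. f i x)"
  by (induction M) (auto simp: suminf_add[symmetric])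

lemma emeasure_kernel_measure:
  assumes K: "mset_kernel K" and \<nu>: "sets \<nu> = sets borel" and B: "B \<in> sets borel"
  shows "emeasure (kernel_measure K \<nu>) B = (\<integral>\<^sup>+ y. (\<Sum>x\<in>#K y. indicator B x) \<partial>\<nu>)"
  unfolding kernel_measure_def
proof (rule emeasure_measure_of_sigma[OF _ _ _ B])
  show "sigma_algebra UNIV (sets (borel :: p1 measure))"
    using sets.sigma_algebra_axioms[of borel] by simp
  show "positive (sets borel) (\<lambda>B. \<integral>\<^sup>+ y. (\<Sum>x\<in>#K y. indicator B x) \<partial>\<nu>)"
    by (simp add: positive_def indicator_def[abs_def])
  show "countably_additive (sets borel) (\<lambda>B. \<integral>\<^sup>+ y. (\<Sum>x\<in>#K y. indicator B x) \<partial>\<nu>)"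
  proof (rule countably_additiveI)
    fix A :: "nat \<Rightarrow> p1 set" assume A: "range A \<subseteq> sets borel" "disjoint_family A"
    have "(\<Sum>i. \<integral>\<^sup>+ y. (\<Sum>x\<in>#K y. indicator (A i) x) \<partial>\<nu>) =
        (\<integral>\<^sup>+ y. (\<Sum>i. \<Sum>x\<in>#K y. indicator (A i) x) \<partial>\<nu>)"
      using A(1) by (intro nn_integral_suminf[symmetric] measurable_kernel_indicator_ennreal[OF K _ \<nu>]) auto
    also have "\<dots> = (\<integral>\<^sup>+ y. (\<Sum>x\<in>#K y. indicator (\<Union>i. A i) x) \<partial>\<nu>)"
      by (simp add: suminf_sum_mset_ennreal suminf_indicator[OF A(2)])
    finally show "(\<Sum>i. \<integral>\<^sup>+ y. (\<Sum>x\<in>#K y. indicator (A i) x) \<partial>\<nu>) =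
        (\<integral>\<^sup>+ y. (\<Sum>x\<in>#K y. indicator (\<Union>i. A i) x) \<partial>\<nu>)" .
  qed
qed

lemma sum_mset_SUP_ennreal:
  fixes U :: "nat \<Rightarrow> 'a \<Rightarrow> ennreal"
  assumes "incseq U"
  shows "(\<Sum>x\<in>#M. SUP i. U i x) = (SUP i. \<Sum>x\<in>#M. U i x)" "incseq (\<lambda>i. \<Sum>x\<in>#M. U i x)"
proof -
  have inc: "incseq (\<lambda>i. U i x)" for x using assms by (auto simp: incseq_def le_fun_def)
  have "(\<Sum>x\<in>#M. SUP i. U i x) = (SUP i. \<Sum>x\<in>#M. U i x) \<and> incseq (\<lambda>i. \<Sum>x\<in>#M. U i x)"
  proof (induction M)
    case (add a M)
    then show ?case using inc[of a] ennreal_SUP_add[OF inc[of a], of "\<lambda>i. \<Sum>x\<in>#M. U i x"]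
      by (auto simp: incseq_def intro!: add_mono)
  qed simp
  then show "(\<Sum>x\<in>#M. SUP i. U i x) = (SUP i. \<Sum>x\<in>#M. U i x)" "incseq (\<lambda>i. \<Sum>x\<in>#M. U i x)"
    by auto
qed

lemma nn_integral_kernel_measure:
  assumes K: "mset_kernel K" and \<nu>: "sets \<nu> = sets borel"
    and f: "f \<in> borel_measurable (kernel_measure K \<nu>)"
  shows "(\<integral>\<^sup>+ x. f x \<partial>kernel_measure K \<nu>) = (\<integral>\<^sup>+ y. (\<Sum>x\<in>#K y. f x) \<partial>\<nu>)"
proof -
  have "(\<integral>\<^sup>+ x. f x \<partial>kernel_measure K \<nu>) = (\<integral>\<^sup>+ y. (\<Sum>x\<in>#K y. f x) \<partial>\<nu>) \<and>
    (\<lambda>y. \<Sum>x\<in>#K y. f x) \<in> borel_measurable \<nu>"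
    using f
  proof (induction rule: borel_measurable_induct)
    case (cong f g)
    then have "f = g" by auto
    then show ?case using cong by simp
  next
    case (set A)
    then show ?case
      using measurable_kernel_indicator_ennreal[OF K _ \<nu>, of A] emeasure_kernel_measure[OF K \<nu>, of A]
      by simp
  next
    case (mult u c)
    have "(\<Sum>x\<in>#M. c * u x) = c * (\<Sum>x\<in>#M. u x)" for M
      by (simp add: sum_mset_distrib_left)
    moreover have [measurable]: "(\<lambda>y. \<Sum>x\<in>#K y. u x) \<in> borel_measurable \<nu>" using mult by simp
    moreover have "(\<lambda>y. c * (\<Sum>x\<in>#K y. u x)) \<in> borel_measurable \<nu>" by measurable
    ultimately show ?case using mult by (simp add: nn_integral_cmult)
  next
    case (add u v)
    have "(\<Sum>x\<in>#M. v x + u x) = (\<Sum>x\<in>#M. v x) + (\<Sum>x\<in>#M. u x)" for M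
      by (simp add: sum_mset.distrib)
    moreover have [measurable]: "(\<lambda>y. \<Sum>x\<in>#K y. v x) \<in> borel_measurable \<nu>"
      "(\<lambda>y. \<Sum>x\<in>#K y. u x) \<in> borel_measurable \<nu>" using add by simp_all
    moreover have "(\<lambda>y. (\<Sum>x\<in>#K y. v x) + (\<Sum>x\<in>#K y. u x)) \<in> borel_measurable \<nu>" by measurable
    ultimately show ?case using add by (simp add: nn_integral_add)
  next
    case (seq U)
    have sup: "(SUP i. U i) = (\<lambda>x. SUP i. U i x)" by (simp add: fun_eq_iff image_comp)
    have "(\<integral>\<^sup>+ x. (SUP i. U i x) \<partial>kernel_measure K \<nu>) = (SUP i. \<integral>\<^sup>+ x. U i x \<partial>kernel_measure K \<nu>)"
      using seq by (intro nn_integral_monotone_convergence_SUP) auto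
    also have "\<dots> = (SUP i. \<integral>\<^sup>+ y. (\<Sum>x\<in>#K y. U i x) \<partial>\<nu>)"
      using seq.IH by simp
    also have "\<dots> = (\<integral>\<^sup>+ y. (SUP i. \<Sum>x\<in>#K y. U i x) \<partial>\<nu>)"
      using seq.IH sum_mset_SUP_ennreal(2)[OF \<open>incseq U\<close>]
      by (intro nn_integral_monotone_convergence_SUP[symmetric]) (auto simp: incseq_def le_fun_def)
    finally have "(\<integral>\<^sup>+ x. (SUP i. U i x) \<partial>kernel_measure K \<nu>) =
        (\<integral>\<^sup>+ y. (\<Sum>x\<in>#K y. SUP i. U i x) \<partial>\<nu>)"
      unfolding sum_mset_SUP_ennreal(1)[OF \<open>incseq U\<close>] .
    moreover have "(\<lambda>y. \<Sum>x\<in>#K y. SUP i. U i x) \<in> borel_measurable \<nu>"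
      unfolding sum_mset_SUP_ennreal(1)[OF \<open>incseq U\<close>] using seq.IH
      by (intro borel_measurable_SUP) auto
    ultimately show ?case unfolding sup by (rule conjI)
  qed
  then show ?thesis ..
qed

section \<open>Pullbacks as kernel measures\<close>

lemma mset_kernel_pencil:
  assumes "nonconst d \<Phi>" shows "mset_kernel (\<lambda>y. zeros (pencil d \<Phi> (rep_cproj y)))"
  unfolding mset_kernel_def zero_sum_def[symmetric]
  by (intro allI impI borel_measurable_continuous_onI continuous_on_zero_sum_pencil
        continuous_intros assms)

lemma mset_kernel_red_pencil:
  assumes "nonconst d \<Phi>" shows "mset_kernel (\<lambda>y. zeros (red_pencil d \<Phi> (rep_cproj y)))"
  unfolding mset_kernel_def
proof (intro allI impI)
  fix \<psi> :: "p1 \<Rightarrow> real" assume "continuous_on UNIV \<psi>"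
  then have "(\<lambda>y. zero_sum \<psi> (pencil d \<Phi> (rep_cproj y)) - zero_sum \<psi> (gcd_form d \<Phi>)) \<in> borel_measurable borel"
    using mset_kernel_pencil[OF assms] unfolding mset_kernel_def zero_sum_def
    by (intro borel_measurable_diff borel_measurable_const) blast
  then show "(\<lambda>y. \<Sum>x\<in>#zeros (red_pencil d \<Phi> (rep_cproj y)). \<psi> x) \<in> borel_measurable borel"
    unfolding zero_sum_pencil[OF assms rep_cproj_nonzero] by (simp add: zero_sum_def)
qed

lemma red_pullback_eq_kernel_measure:
  assumes "nonconst d \<Phi>"
  shows "red_pullback d \<Phi> \<nu> = kernel_measure (\<lambda>y. zeros (red_pencil d \<Phi> (rep_cproj y))) \<nu>"
  unfolding red_pullback_def kernel_measure_def fun_push_eq_zero_sum[OF assms] zero_sum_def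
    ennreal_indicator_sum_mset ..

text \<open>
  The holes contribute the same amount for every \<open>y\<close>. As \<open>\<nu>\<close> has total mass one, they can be moved
  under the integral, where they complete the fibre of the reduction to the zeros of the pencil.
\<close>
lemma pullback_eq_kernel_measure:
  assumes nc: "nonconst d \<Phi>" and \<nu>: "sets \<nu> = sets borel" "prob_space \<nu>"
  shows "pullback d \<Phi> \<nu> = kernel_measure (\<lambda>y. zeros (pencil d \<Phi> (rep_cproj y))) \<nu>"
  unfolding pullback_def kernel_measure_def
proof (rule measure_of_eq)
  show "sets borel \<subseteq> Pow (UNIV :: p1 set)" by simp
  fix B :: "p1 set" assume "B \<in> sigma_sets UNIV (sets borel)"
  then have B: "B \<in> sets borel" using sets.sigma_sets_eq[of "borel :: p1 measure"] by simp
  interpret prob_space \<nu> by fact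
  let ?I = "indicator B :: p1 \<Rightarrow> ennreal"
  have "emeasure (red_pullback d \<Phi> \<nu>) B + (\<Sum>x | hole_mult d \<Phi> x \<noteq> 0. of_nat (hole_mult d \<Phi> x) * ?I x)
      = (\<integral>\<^sup>+ y. zero_sum ?I (red_pencil d \<Phi> (rep_cproj y)) \<partial>\<nu>) + zero_sum ?I (gcd_form d \<Phi>)"
    unfolding red_pullback_eq_kernel_measure[OF nc] zero_sum_hole_mult[OF nc]
      emeasure_kernel_measure[OF mset_kernel_red_pencil[OF nc] \<nu>(1) B] by (simp add: zero_sum_def)
  also have "\<dots> = (\<integral>\<^sup>+ y. zero_sum ?I (red_pencil d \<Phi> (rep_cproj y)) + zero_sum ?I (gcd_form d \<Phi>) \<partial>\<nu>)"
    using measurable_kernel_indicator_ennreal[OF mset_kernel_red_pencil[OF nc] B \<nu>(1)]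
    by (subst nn_integral_add) (simp_all add: zero_sum_def emeasure_space_1)
  also have "\<dots> = (\<integral>\<^sup>+ y. (\<Sum>x\<in>#zeros (pencil d \<Phi> (rep_cproj y)). ?I x) \<partial>\<nu>)"
    unfolding zero_sum_def[symmetric] zero_sum_pencil[OF nc rep_cproj_nonzero] by (simp add: add.commute)
  finally show "emeasure (red_pullback d \<Phi> \<nu>) B + (\<Sum>x | hole_mult d \<Phi> x \<noteq> 0. of_nat (hole_mult d \<Phi> x) * ?I x)
      = (\<integral>\<^sup>+ y. (\<Sum>x\<in>#zeros (pencil d \<Phi> (rep_cproj y)). ?I x) \<partial>\<nu>)" .
qed

text \<open>
  The invariance of \<open>\<mu>\<close>, extended from Borel sets to nonnegative continuous functions.
\<close>
lemma max_entropy_measure_integral: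
  fixes \<psi> :: "p1 \<Rightarrow> real"
  assumes \<Phi>: "\<Phi> \<in> Rat d" "d \<ge> 1" and \<mu>: "max_entropy_measure d \<Phi> \<mu>"
    and \<psi>: "continuous_on UNIV \<psi>" "\<And>x. 0 \<le> \<psi> x"
  shows "(\<integral>y. zero_sum \<psi> (pencil d \<Phi> (rep_cproj y)) \<partial>\<mu>) = real d * (\<integral>x. \<psi> x \<partial>\<mu>)"
proof -
  note nc = nonconst_Rat[OF \<Phi>]
  have sets: "sets \<mu> = sets borel" using \<mu> by (simp add: max_entropy_measure_def)
  have inv: "scale_measure (ennreal (1 / real d))
      (kernel_measure (\<lambda>y. zeros (pencil d \<Phi> (rep_cproj y))) \<mu>) = \<mu>"
    using \<mu> unfolding max_entropy_measure_def red_pullback_eq_kernel_measure[OF nc] red_pencil_Rat[OF \<Phi>(1)]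
    by simp
  have m: "\<psi> \<in> borel_measurable borel" using \<psi>(1) by (rule borel_measurable_continuous_onI)
  have m': "(\<lambda>y. zero_sum \<psi> (pencil d \<Phi> (rep_cproj y))) \<in> borel_measurable borel"
    using mset_kernel_pencil[OF nc] \<psi>(1) by (simp add: mset_kernel_def zero_sum_def)
  have nonneg: "0 \<le> (\<Sum>x\<in>#M. \<psi> x)" for M using \<psi>(2) by (induction M) auto
  have "(\<lambda>x. ennreal (\<psi> x)) \<in> borel_measurable (kernel_measure (\<lambda>y. zeros (pencil d \<Phi> (rep_cproj y))) \<mu>)"
    using m by (simp cong: measurable_cong_sets)
  from nn_integral_scale_measure[OF this, of "ennreal (1 / real d)", unfolded inv]
  have "(\<integral>\<^sup>+ x. ennreal (\<psi> x) \<partial>\<mu>) = ennreal (1 / real d) *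
      (\<integral>\<^sup>+ x. ennreal (\<psi> x) \<partial>kernel_measure (\<lambda>y. zeros (pencil d \<Phi> (rep_cproj y))) \<mu>)" .
  also have "(\<integral>\<^sup>+ x. ennreal (\<psi> x) \<partial>kernel_measure (\<lambda>y. zeros (pencil d \<Phi> (rep_cproj y))) \<mu>) =
      (\<integral>\<^sup>+ y. (\<Sum>x\<in>#zeros (pencil d \<Phi> (rep_cproj y)). ennreal (\<psi> x)) \<partial>\<mu>)"
    using m by (intro nn_integral_kernel_measure mset_kernel_pencil nc sets) (simp cong: measurable_cong_sets)
  also have "\<dots> = (\<integral>\<^sup>+ y. ennreal (zero_sum \<psi> (pencil d \<Phi> (rep_cproj y))) \<partial>\<mu>)"
    unfolding zero_sum_def by (simp add: ennreal_sum_mset \<psi>(2))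
  finally have "enn2real (\<integral>\<^sup>+ x. ennreal (\<psi> x) \<partial>\<mu>) = (1 / real d) *
      enn2real (\<integral>\<^sup>+ y. ennreal (zero_sum \<psi> (pencil d \<Phi> (rep_cproj y))) \<partial>\<mu>)"
    by (simp add: enn2real_mult)
  moreover have "(\<integral>x. \<psi> x \<partial>\<mu>) = enn2real (\<integral>\<^sup>+ x. ennreal (\<psi> x) \<partial>\<mu>)"
    using m \<psi>(2) by (intro integral_eq_nn_integral) (auto cong: measurable_cong_sets simp: sets)
  moreover have "(\<integral>y. zero_sum \<psi> (pencil d \<Phi> (rep_cproj y)) \<partial>\<mu>) =
      enn2real (\<integral>\<^sup>+ y. ennreal (zero_sum \<psi> (pencil d \<Phi> (rep_cproj y))) \<partial>\<mu>)"
    using m' nonneg by (intro integral_eq_nn_integral) (auto cong: measurable_cong_sets simp: sets zero_sum_def)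
  ultimately show ?thesis using \<Phi>(2) by simp
qed

text \<open>
  Apply the hypothesis to continuous functions converging to the indicator function of a closed set.
  Dominated convergence applies on both sides, because every member of the pencil has exactly \<open>d\<close>
  zeros. Finite measures that agree on closed sets are equal.
\<close>
lemma pullback_eqI:
  assumes nc: "nonconst d \<Phi>" and d: "d \<ge> 1"
    and \<nu>: "sets \<nu> = sets borel" "prob_space \<nu>" and \<rho>: "sets \<rho> = sets borel" "prob_space \<rho>"
    and eq: "\<And>\<psi> :: p1 \<Rightarrow> real. continuous_on UNIV \<psi> \<Longrightarrow> (\<And>x. 0 \<le> \<psi> x) \<Longrightarrow> (\<And>x. \<psi> x \<le> 1) \<Longrightarrow>
      (\<integral>y. zero_sum \<psi> (pencil d \<Phi> (rep_cproj y)) \<partial>\<nu>) = real d * (\<integral>x. \<psi> x \<partial>\<rho>)"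
  shows "scale_measure (ennreal (1 / real d)) (pullback d \<Phi> \<nu>) = \<rho>"
proof -
  interpret \<nu>: prob_space \<nu> by fact
  interpret \<rho>: prob_space \<rho> by fact
  define K where "K = (\<lambda>y. zeros (pencil d \<Phi> (rep_cproj y)))"
  define L where "L = scale_measure (ennreal (1 / real d)) (kernel_measure K \<nu>)"
  have K: "mset_kernel K" unfolding K_def by (rule mset_kernel_pencil[OF nc])
  have sp: "space \<rho> = UNIV" using sets_eq_imp_space_eq[OF \<rho>(1)] by simp
  have closed_eq: "emeasure L C = emeasure \<rho> C" if C: "closed C" for C
  proof -
    have Cb: "C \<in> sets borel" using C by simp
    obtain \<psi> :: "nat \<Rightarrow> p1 \<Rightarrow> real" where \<psi>: "\<And>n. continuous_on UNIV (\<psi> n)" "\<And>n x. 0 \<le> \<psi> n x"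
      "\<And>n x. \<psi> n x \<le> 1" "\<And>x. (\<lambda>n. \<psi> n x) \<longlonglongrightarrow> indicat_real C x"
      by (rule closed_p1_approx[OF C]) blast
    have m: "\<psi> n \<in> borel_measurable \<rho>" for n
      using borel_measurable_continuous_onI[OF \<psi>(1)] by (simp cong: measurable_cong_sets add: \<rho>)
    have mK: "(\<lambda>y. \<Sum>x\<in>#K y. \<psi> n x) \<in> borel_measurable \<nu>" for n
      using K \<psi>(1) by (simp cong: measurable_cong_sets add: \<nu> mset_kernel_def)
    have mC: "(\<lambda>y. \<Sum>x\<in>#K y. indicat_real C x) \<in> borel_measurable \<nu>"
      using measurable_kernel_indicator[OF K Cb] by (simp cong: measurable_cong_sets add: \<nu>)
    have bound: "0 \<le> (\<Sum>x\<in>#M. f x) \<and> (\<Sum>x\<in>#M. f x) \<le> real (size M)"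
      if "\<And>x. 0 \<le> f x \<and> f x \<le> 1" for M and f :: "p1 \<Rightarrow> real"
      by (induction M) (use that in \<open>auto intro!: add_mono\<close>)
    have lim: "(\<lambda>n. \<Sum>x\<in>#K y. \<psi> n x) \<longlonglongrightarrow> (\<Sum>x\<in>#K y. indicat_real C x)" for y
      by (rule tendsto_sum_mset[OF \<psi>(4)])
    have size: "size (K y) = d" for y
      unfolding K_def by (rule size_zeros_pencil[OF nc rep_cproj_nonzero])
    have "(\<lambda>n. \<integral>x. \<psi> n x \<partial>\<rho>) \<longlonglongrightarrow> (\<integral>x. indicat_real C x \<partial>\<rho>)"
      by (rule integral_dominated_convergence[where w = "\<lambda>_. 1"]) (use \<psi> m Cb \<rho> in auto)
    then have "(\<lambda>n. real d * (\<integral>x. \<psi> n x \<partial>\<rho>)) \<longlonglongrightarrow> real d * measure \<rho> C"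
      using Cb \<rho>(1) by (intro tendsto_intros) simp
    moreover have "(\<lambda>n. \<integral>y. (\<Sum>x\<in>#K y. \<psi> n x) \<partial>\<nu>) \<longlonglongrightarrow> (\<integral>y. (\<Sum>x\<in>#K y. indicat_real C x) \<partial>\<nu>)"
    proof (rule integral_dominated_convergence[where w = "\<lambda>_. real d"])
      show "AE y in \<nu>. norm (\<Sum>x\<in>#K y. \<psi> n x) \<le> real d" for n
        using bound[of "\<psi> n" "K _"] \<psi>(2,3) by (auto simp: size)
    qed (use mK mC lim in auto)
    moreover have "(\<integral>y. (\<Sum>x\<in>#K y. \<psi> n x) \<partial>\<nu>) = real d * (\<integral>x. \<psi> n x \<partial>\<rho>)" for n
      using eq[OF \<psi>(1-3)] by (simp add: K_def zero_sum_def)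
    ultimately have int: "(\<integral>y. (\<Sum>x\<in>#K y. indicat_real C x) \<partial>\<nu>) = real d * measure \<rho> C"
      using LIMSEQ_unique by simp
    have "emeasure (kernel_measure K \<nu>) C = (\<integral>\<^sup>+ y. ennreal (\<Sum>x\<in>#K y. indicat_real C x) \<partial>\<nu>)"
      unfolding emeasure_kernel_measure[OF K \<nu>(1) Cb] ennreal_indicator_sum_mset ..
    also have "\<dots> = ennreal (\<integral>y. (\<Sum>x\<in>#K y. indicat_real C x) \<partial>\<nu>)"
    proof (rule nn_integral_eq_integral)
      show "integrable \<nu> (\<lambda>y. \<Sum>x\<in>#K y. indicat_real C x)"
        using bound[of "indicat_real C" "K _"] mC
        by (intro \<nu>.integrable_const_bound[where B = "real d"]) (auto simp: size)
    qed (use bound[of "indicat_real C" "K _"] in auto)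
    finally have "emeasure L C = ennreal (1 / real d) * ennreal (real d * measure \<rho> C)"
      unfolding L_def int by simp
    also have "\<dots> = ennreal (measure \<rho> C)" using d by (simp flip: ennreal_mult)
    finally show ?thesis by (simp add: \<rho>.emeasure_eq_measure)
  qed
  have "L = \<rho>"
  proof (rule measure_eqI_generator_eq[of "Collect closed" UNIV _ _ "\<lambda>_. UNIV"])
    have "sets (borel :: p1 measure) = sigma_sets UNIV (Collect closed)"
      unfolding borel_eq_closed by simp
    then show "sets L = sigma_sets UNIV (Collect closed)" "sets \<rho> = sigma_sets UNIV (Collect closed)"
      using \<rho>(1) unfolding L_def by simp_all
    show "emeasure L C = emeasure \<rho> C" if "C \<in> Collect closed" for C
      using closed_eq that by simp
    show "emeasure L UNIV \<noteq> \<infinity>" for i :: nat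
      using closed_eq[of UNIV] \<rho>.emeasure_space_1 sp by simp
  qed (auto simp: Int_stable_def)
  then show ?thesis unfolding L_def K_def pullback_eq_kernel_measure[OF nc \<nu>] .
qed

section \<open>Weak limits\<close>

text \<open>
  A common form of both cases of the main result. The fibre of \<open>Y\<close> over \<open>t\<close> carries a coordinate \<open>pX\<close>, in
  which \<open>f t\<close> acts, and a coordinate \<open>pE\<close> on the target, in which \<open>h t\<close> takes its values; they are
  related by the last hypothesis. The function \<open>\<Psi>\<close> below is the continuous
  extension to \<open>Y\<close> of the pushforwards of \<open>\<psi>\<close>, and the result follows by applying weak convergence
  both to \<open>\<Psi>\<close> and to \<open>\<psi> \<circ> pX\<close>.
\<close>
theorem weak_limit_pullback:
  fixes Y :: "(complex \<times> 'z::topological_space) set" and pX pE :: "complex \<times> 'z \<Rightarrow> p1"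
  assumes d: "d \<ge> 1" and r: "0 < r" and lim: "weak_limit r Y \<iota> \<mu> \<mu>\<^sub>0"
    and Y: "Y \<subseteq> ball 0 r \<times> UNIV"
    and pX: "continuous_on UNIV pX" and pE: "continuous_on UNIV pE"
    and \<iota>: "\<And>t z. t \<in> ball 0 r - {0} \<Longrightarrow> fst (\<iota> t z) = t" "\<And>t z. t \<in> ball 0 r - {0} \<Longrightarrow> pX (\<iota> t z) = z"
    and h: "continuous_on (ball 0 r) h" "\<And>t. t \<in> ball 0 r \<Longrightarrow> nonconst d (h t)"
    and f: "\<And>t. t \<in> ball 0 r - {0} \<Longrightarrow> f t \<in> Rat d"
    and \<mu>: "\<And>t. t \<in> ball 0 r - {0} \<Longrightarrow> max_entropy_measure d (f t) (\<mu> t)"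
    and conj: "\<And>t z. t \<in> ball 0 r - {0} \<Longrightarrow>
      zeros (pencil d (h t) (rep_cproj (pE (\<iota> t z)))) = zeros (pencil d (f t) (rep_cproj z))"
  shows "scale_measure (ennreal (1 / real d)) (pullback d (h 0) (distr \<mu>\<^sub>0 borel pE)) = distr \<mu>\<^sub>0 borel pX"
proof -
  obtain t where sets: "sets \<mu>\<^sub>0 = sets (restrict_space borel (central_fibre Y))"
    and t: "\<And>n. t n \<in> ball 0 r - {0}"
    and conv: "\<And>\<psi> :: complex \<times> 'z \<Rightarrow> real. continuous_on Y \<psi> \<Longrightarrow>
      (\<lambda>n. \<integral>z. \<psi> (\<iota> (t n) z) \<partial>\<mu> (t n)) \<longlonglongrightarrow> (\<integral>p. \<psi> p \<partial>\<mu>\<^sub>0)"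
    using lim unfolding weak_limit_def by blast
  have space: "space \<mu>\<^sub>0 = central_fibre Y"
    using sets_eq_imp_space_eq[OF sets] by (simp add: space_restrict_space)
  have meas: "g \<in> measurable \<mu>\<^sub>0 borel" if "continuous_on UNIV g" for g :: "complex \<times> 'z \<Rightarrow> p1"
    using measurable_restrict_space1[OF borel_measurable_continuous_onI[OF that]]
    unfolding measurable_cong_sets[OF sets refl] .
  \<comment> \<open>No mass escapes, as \<open>1\<close> is a test function. Infinite mass is excluded as well, since the integral
    of \<open>1\<close> would be \<open>0\<close> by convention.\<close>
  have "(\<lambda>n. \<integral>z. 1 \<partial>\<mu> (t n)) \<longlonglongrightarrow> (\<integral>p. 1 \<partial>\<mu>\<^sub>0 :: real)"
    by (rule conv) (rule continuous_on_const)
  moreover have "(\<lambda>n. \<integral>z. 1 \<partial>\<mu> (t n)) = (\<lambda>n. 1 :: real)"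
    using \<mu>[OF t] by (simp add: max_entropy_measure_def prob_space.prob_space)
  ultimately have "(\<lambda>n :: nat. 1 :: real) \<longlonglongrightarrow> (\<integral>p. 1 \<partial>\<mu>\<^sub>0)" by (simp only:)
  then have "(\<integral>p. 1 \<partial>\<mu>\<^sub>0) = (1 :: real)" by (rule LIMSEQ_unique) (rule tendsto_const)
  then have "measure \<mu>\<^sub>0 (space \<mu>\<^sub>0) = 1" by simp
  then have "emeasure \<mu>\<^sub>0 (space \<mu>\<^sub>0) = 1"
    by (cases "emeasure \<mu>\<^sub>0 (space \<mu>\<^sub>0)" rule: ennreal_cases) (auto simp: measure_def)
  then have "prob_space \<mu>\<^sub>0" by (rule prob_spaceI)
  then interpret \<mu>\<^sub>0: prob_space \<mu>\<^sub>0 .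
  show ?thesis
  proof (rule pullback_eqI)
    show "nonconst d (h 0)" using h(2) r by simp
    show "prob_space (distr \<mu>\<^sub>0 borel pE)" "prob_space (distr \<mu>\<^sub>0 borel pX)"
      by (intro \<mu>\<^sub>0.prob_space_distr meas pX pE)+
    fix \<psi> :: "p1 \<Rightarrow> real"
    assume \<psi>: "continuous_on UNIV \<psi>" "\<And>x. 0 \<le> \<psi> x"
    define \<Psi> where "\<Psi> p = zero_sum \<psi> (pencil d (h (fst p)) (rep_cproj (pE p)))" for p
    have "continuous_on Y \<Psi>" unfolding \<Psi>_def
    proof (rule continuous_on_zero_sum_pencil[OF \<psi>(1)])
      show "continuous_on Y (\<lambda>p. h (fst p))"
        using Y by (intro continuous_on_compose2[OF h(1)] continuous_intros) auto
      show "continuous_on Y pE" using pE continuous_on_subset by blast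
      show "nonconst d (h (fst p))" if "p \<in> Y" for p using h(2) that Y by (cases p) auto
    qed
    then have "(\<lambda>n. \<integral>z. \<Psi> (\<iota> (t n) z) \<partial>\<mu> (t n)) \<longlonglongrightarrow> (\<integral>p. \<Psi> p \<partial>\<mu>\<^sub>0)" by (rule conv)
    moreover have "continuous_on Y (\<lambda>p. \<psi> (pX p))"
      using pX by (intro continuous_on_compose2[OF \<psi>(1)]) (auto intro: continuous_on_subset)
    then have "(\<lambda>n. real d * (\<integral>z. \<psi> (pX (\<iota> (t n) z)) \<partial>\<mu> (t n))) \<longlonglongrightarrow> real d * (\<integral>p. \<psi> (pX p) \<partial>\<mu>\<^sub>0)"
      by (intro tendsto_intros conv)
    moreover have "(\<integral>z. \<Psi> (\<iota> (t n) z) \<partial>\<mu> (t n)) = real d * (\<integral>z. \<psi> (pX (\<iota> (t n) z)) \<partial>\<mu> (t n))" for n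
      using max_entropy_measure_integral[OF f[OF t] d \<mu>[OF t] \<psi>, of n]
      by (simp add: \<Psi>_def \<iota>[OF t] conj[OF t] zero_sum_def)
    ultimately have eq: "(\<integral>p. \<Psi> p \<partial>\<mu>\<^sub>0) = real d * (\<integral>p. \<psi> (pX p) \<partial>\<mu>\<^sub>0)"
      using LIMSEQ_unique by simp
    have "(\<integral>p. \<Psi> p \<partial>\<mu>\<^sub>0) = (\<integral>p. zero_sum \<psi> (pencil d (h 0) (rep_cproj (pE p))) \<partial>\<mu>\<^sub>0)"
      by (intro Bochner_Integration.integral_cong refl) (simp add: space central_fibre_def \<Psi>_def)
    also have "\<dots> = (\<integral>y. zero_sum \<psi> (pencil d (h 0) (rep_cproj y)) \<partial>distr \<mu>\<^sub>0 borel pE)"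
      using mset_kernel_pencil[OF h(2), of 0] r \<psi>(1)
      by (intro integral_distr[symmetric] meas pE) (simp add: mset_kernel_def zero_sum_def)
    finally show "(\<integral>y. zero_sum \<psi> (pencil d (h 0) (rep_cproj y)) \<partial>distr \<mu>\<^sub>0 borel pE) =
        real d * (\<integral>x. \<psi> x \<partial>distr \<mu>\<^sub>0 borel pX)"
      unfolding eq using integral_distr[OF meas[OF pX] borel_measurable_continuous_onI[OF \<psi>(1)]] by simp
  qed (use d in simp_all)
qed

theorem theorem3p1:
  fixes d :: nat and f :: "complex \<Rightarrow> ratpt" and r :: real and \<mu> :: "complex \<Rightarrow> p1 measure"
  assumes "d \<ge> 2"
    and "meromorphic_family d (ball 0 1) f"
    and "f 0 \<in> bd_Rat d"
    and "0 < r" and "r \<le> 1"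
    and "\<forall>t \<in> ball 0 r - {0}. f t \<in> Rat d"
    and "\<forall>t \<in> ball 0 r - {0}. max_entropy_measure d (f t) (\<mu> t)"
  shows "(\<not> reduction d (f 0) constant_on UNIV \<longrightarrow>
            (\<forall>\<mu>\<^sub>0. weak_limit r (surface_X r) (\<lambda>t z. (t, z)) \<mu> \<mu>\<^sub>0 \<longrightarrow>
               scale_measure (ennreal (1 / real d)) (pullback d (f 0) (distr \<mu>\<^sub>0 borel snd))
                 = distr \<mu>\<^sub>0 borel snd)) \<and>
         (reduction d (f 0) constant_on UNIV \<longrightarrow>
            (\<forall>A \<Phi> \<mu>\<^sub>0.
               meromorphic_family 1 (ball 0 r) A \<longrightarrow>
               (\<forall>t \<in> ball 0 r - {0}. A t \<in> Rat 1) \<longrightarrow>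
               \<Phi> \<in> Rat_bar d \<longrightarrow>
               ((\<lambda>t. moebius_comp (A t) (f t)) \<longlongrightarrow> \<Phi>) (at 0) \<longrightarrow>
               \<not> reduction d \<Phi> constant_on UNIV \<longrightarrow>
               weak_limit r (surface_Y r A) (\<lambda>t z. (t, z, reduction 1 (A t) z)) \<mu> \<mu>\<^sub>0 \<longrightarrow>
               scale_measure (ennreal (1 / real d)) (pullback d \<Phi> (distr \<mu>\<^sub>0 borel proj_E))
                 = distr \<mu>\<^sub>0 borel (snd \<circ> proj_X)))"
proof -
  have d: "d \<ge> 1" using assms(1) by simp
  have fcont: "continuous_on (ball 0 r) f"
    using assms(2,5) unfolding meromorphic_family_def
    by (meson continuous_on_holomorphic_to_proj continuous_on_subset subset_ball)
  have nc: "nonconst d (f t)" if "t \<in> ball 0 r - {0}" for t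
    using assms(6) that d by (intro nonconst_Rat) auto
  show ?thesis
  proof (intro conjI impI allI)
    fix \<mu>\<^sub>0
    assume red: "\<not> reduction d (f 0) constant_on UNIV"
      and lim: "weak_limit r (surface_X r) (\<lambda>t z. (t, z)) \<mu> \<mu>\<^sub>0"
    have "nonconst d (f 0)" using assms(3) red by (intro nonconst_reduction) (auto simp: bd_Rat_def)
    then have nc': "nonconst d (f t)" if "t \<in> ball 0 r" for t using nc[of t] that by (cases "t = 0") auto
    show "scale_measure (ennreal (1 / real d)) (pullback d (f 0) (distr \<mu>\<^sub>0 borel snd)) = distr \<mu>\<^sub>0 borel snd"
      by (rule weak_limit_pullback[OF d assms(4) lim _ _ _ _ _ fcont nc', of snd snd f])
         (use assms(6,7) in \<open>auto simp: surface_X_def intro: continuous_intros\<close>)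
  next
    fix A \<Phi> \<mu>\<^sub>0
    assume A: "meromorphic_family 1 (ball 0 r) A" "\<forall>t \<in> ball 0 r - {0}. A t \<in> Rat 1"
      and \<Phi>: "\<Phi> \<in> Rat_bar d" "((\<lambda>t. moebius_comp (A t) (f t)) \<longlongrightarrow> \<Phi>) (at 0)"
        "\<not> reduction d \<Phi> constant_on UNIV"
      and lim: "weak_limit r (surface_Y r A) (\<lambda>t z. (t, z, reduction 1 (A t) z)) \<mu> \<mu>\<^sub>0"
    define h where "h t = (if t = 0 then \<Phi> else moebius_comp (A t) (f t))" for t
    have Acont: "continuous_on (ball 0 r) A"
      using A(1) unfolding meromorphic_family_def by (blast intro: continuous_on_holomorphic_to_proj)
    have hcont: "continuous_on (ball 0 r) h"
      unfolding continuous_on_def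
    proof
      fix t :: complex assume t: "t \<in> ball 0 r"
      have "((\<lambda>s. moebius_comp (A s) (f s)) \<longlongrightarrow> h t) (at t)"
      proof (cases "t = 0")
        case True
        then show ?thesis using \<Phi>(2) by (simp add: h_def)
      next
        case False
        then show ?thesis using A(2) t Acont fcont
          by (auto simp: h_def continuous_on_eq_continuous_at isCont_def intro!: tendsto_moebius_comp)
      qed
      moreover have "\<forall>\<^sub>F s in at t. s \<noteq> 0"
      proof (cases "t = 0")
        case True
        then show ?thesis by (simp add: eventually_at_filter)
      next
        case False
        then show ?thesis using eventually_at_in_open'[OF open_Compl[OF closed_singleton[of 0]], of t] by simp
      qed
      then have "\<forall>\<^sub>F s in at t. moebius_comp (A s) (f s) = h s"
        by eventually_elim (simp add: h_def)
      ultimately have "(h \<longlongrightarrow> h t) (at t)" by (rule Lim_transform_eventually)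
      then show "(h \<longlongrightarrow> h t) (at t within ball 0 r)" by (rule tendsto_within_subset) simp
    qed
    have hnc: "nonconst d (h t)" if "t \<in> ball 0 r" for t :: complex
      using nonconst_reduction[OF \<Phi>(1,3)] nonconst_moebius_comp[OF _ nc] A(2) that
      by (auto simp: h_def)
    have "scale_measure (ennreal (1 / real d)) (pullback d (h 0) (distr \<mu>\<^sub>0 borel proj_E)) =
        distr \<mu>\<^sub>0 borel (snd \<circ> proj_X)"
    proof (rule weak_limit_pullback[OF d assms(4) lim _ _ _ _ _ hcont hnc])
      show "continuous_on UNIV proj_E" "continuous_on UNIV (snd \<circ> proj_X)"
        unfolding proj_E_def proj_X_def by (auto simp: split_beta o_def intro!: continuous_intros)
      fix t :: complex and z assume t: "t \<in> ball 0 r - {0}"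
      then show "zeros (pencil d (h t) (rep_cproj (proj_E (t, z, reduction 1 (A t) z)))) =
          zeros (pencil d (f t) (rep_cproj z))"
        using zeros_pencil_moebius_comp[of "A t" d "f t" z] A(2) by (simp add: h_def proj_E_def)
    qed (use assms(6,7) in \<open>auto simp: surface_Y_def proj_X_def\<close>)
    then show "scale_measure (ennreal (1 / real d)) (pullback d \<Phi> (distr \<mu>\<^sub>0 borel proj_E)) =
        distr \<mu>\<^sub>0 borel (snd \<circ> proj_X)"
      by (simp add: h_def)
  qed
qed

end
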